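(* Let $m_0\ge1$, $N_1\in\mathbb{Z}$, $\mathbf{N}=(N_1,N_1+2m_0-1)$, and let $0\leq t_1<t_2<\dots<t_{m_0}<2\pi$. Let $f\in L^2(\mathbb{T})$ be a square integrable function (not necessarily bandlimited) with Fourier coefficients $a(n)$, $n\in\mathbb{Z}$. Then the averaged error $\varepsilon(f,\mathbf{N})$ of reconstructing $f$ by the operator $\mathcal{T}_{\mathbf{N}}$, which uses samples of $f$ and of its derivative $f'$ at the points $t_p$, satisfies $$\varepsilon(f,\mathbf{N})^2=\sum_{n\notin I^{\mathbf{N}}}|a(n)|^2\,Er(\mathbf{N},n),$$ where $$Er(\mathbf{N},n)=1+\sum_{k=1}^{2m_0}\left|\sum_{p=1}^{m_0}\left(e^{\mathrm{i}nt_p}w_{2p-1}(k)+\mathrm{i}n\,e^{\mathrm{i}nt_p}w_{2p}(k)\right)\right|^2 .$$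
   Context: Here $\mathrm{i}$ is the imaginary unit, $\mathbb{T}$ is the unit circle (functions on $\mathbb{T}$ are identified with $2\pi$-periodic functions), $L^2(\mathbb{T})$ is the space of square integrable functions on $\mathbb{T}$, $a(n)=\frac1{2\pi}\int_{\mathbb{T}}f(t)e^{-\mathrm{i}nt}\,dt$, $\|g\|_2^2=\frac1{2\pi}\int_{\mathbb{T}}|g(t)|^2dt$, and $I^{\mathbf{N}}=\{n\in\mathbb{Z}:N_1\le n\le N_1+2m_0-1\}$. A function is called bandlimited if it is a trigonometric polynomial of finite order. Let $\mathbf{H}=[v_{kj}]_{1\le k,j\le 2m_0}$ be the square matrix with entries $$v_{kj}=\begin{cases} e^{\mathrm{i}(N_1+k-1)t_p}, & j=2p-1,\\ \mathrm{i}(N_1+k-1)e^{\mathrm{i}(N_1+k-1)t_p}, & j=2p,\end{cases}\qquad 1\le p\le m_0 .$$ The matrix $\mathbf{H}$ is invertible (the points being distinct in $[0,2\pi)$). Let $w_j(k)$ denote the $(j,k)$ element of $\mathbf{H}^{-1}$, and put $$\phi_p(t)=\sum_{k=1}^{2m_0}w_{2p}(k)\,e^{\mathrm{i}(N_1+k-1)t},\qquad \psi_p(t)=\sum_{k=1}^{2m_0}w_{2p-1}(k)\,e^{\mathrm{i}(N_1+k-1)t}.$$ The reconstruction operator is $\mathcal{T}_{\mathbf{N}}g(t)=\sum_{p=1}^{m_0}\bigl(g(t_p)\psi_p(t)+g'(t_p)\phi_p(t)\bigr)$. For $\tau\in\mathbb{R}$ let $f_\tau(t)=f(t-\tau)$,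 so that $\mathcal{T}_{\mathbf{N}}f_\tau(t)=\sum_{p=1}^{m_0}\bigl(f(t_p-\tau)\psi_p(t)+f'(t_p-\tau)\phi_p(t)\bigr)$. The averaged error is $$\varepsilon(f,\mathbf{N})=\sqrt{\frac1{2\pi}\int_0^{2\pi}\left\|f_\tau-\mathcal{T}_{\mathbf{N}}f_\tau\right\|_2^2\,d\tau}\, .$$
   Formalization: For general f in L² the derivative f' is undefined, and with an a.e. pointwise f' the formula fails (sawtooth); the formal theorem assumes f equals a.e. an indefinite (Henstock–Kurzweil) integral of a 2π-periodic f', and both sides may be infinite. *)

theory Defs
  imports "HOL-Analysis.Analysis" "Jordan_Normal_Form.Gauss_Jordan_Elimination"
begin

text \<open>Functions on the circle are \<open>2 * pi\<close>-periodic functions on the real line. Norms and errors take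
  values in \<^typ>\<open>ennreal\<close>, so that an infinite value is not confused with a finite one.\<close>

definition periodic_2pi :: "(real \<Rightarrow> complex) \<Rightarrow> bool" where
  "periodic_2pi f \<longleftrightarrow> (\<forall>x. f (x + 2 * pi) = f x)"

definition L2_circle :: "(real \<Rightarrow> complex) set" where
  "L2_circle = {f. periodic_2pi f \<and> f \<in> borel_measurable lebesgue \<and>
     set_integrable lebesgue {0..2 * pi} (\<lambda>x. (cmod (f x))\<^sup>2)}"

definition fourier_coeff :: "(real \<Rightarrow> complex) \<Rightarrow> int \<Rightarrow> complex" where
  "fourier_coeff f n =
     (LINT x:{0..2 * pi}|lebesgue. f x * cis (- (of_int n * x))) / complex_of_real (2 * pi)"

definition ennreal_sqrt :: "ennreal \<Rightarrow> ennreal" where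
  "ennreal_sqrt x = (if x = \<infinity> then \<infinity> else ennreal (sqrt (enn2real x)))"

definition norm2 :: "(real \<Rightarrow> complex) \<Rightarrow> ennreal" where
  "norm2 g = ennreal_sqrt
     (ennreal (1 / (2 * pi)) * (\<integral>\<^sup>+ x\<in>{0..2 * pi}. ennreal ((cmod (g x))\<^sup>2) \<partial>lebesgue))"

text \<open>\<open>f'\<close> is the derivative of \<open>f\<close> if \<open>f\<close> agrees almost everywhere with an indefinite
  Henstock-Kurzweil integral of \<open>f'\<close>. This includes everywhere differentiable functions with their
  pointwise derivative (see below), absolutely continuous functions with their almost everywhere
  derivative, and integrable weak derivatives. Mere differentiability almost everywhere is not
  enough: it would admit jumps and Cantor-type functions, whose pointwise derivative does not
  have the Fourier coefficients \<open>i n a(n)\<close>.\<close>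

definition circle_derivative :: "(real \<Rightarrow> complex) \<Rightarrow> (real \<Rightarrow> complex) \<Rightarrow> bool" where
  "circle_derivative f f' \<longleftrightarrow> periodic_2pi f' \<and>
     (\<exists>F. (\<forall>a b. a \<le> b \<longrightarrow> (f' has_integral (F b - F a)) {a..b}) \<and> (AE x in lebesgue. f x = F x))"

lemma circle_derivative_classical:
  assumes per: "periodic_2pi f" and der: "\<And>x. (f has_vector_derivative f' x) (at x)"
  shows "circle_derivative f f'"
proof -
  have "f' (x + 2 * pi) = f' x" for x
  proof -
    have "((f \<circ> (\<lambda>y. y + 2 * pi)) has_vector_derivative 1 *\<^sub>R f' (x + 2 * pi)) (at x)"
      by (rule vector_diff_chain_at) (auto intro!: derivative_eq_intros der)
    moreover have "f \<circ> (\<lambda>y. y + 2 * pi) = f"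
      using per by (auto simp: periodic_2pi_def)
    ultimately show ?thesis
      using der[of x] vector_derivative_unique_at by fastforce
  qed
  moreover have "(f' has_integral (f b - f a)) {a..b}" if "a \<le> b" for a b
    using that by (rule fundamental_theorem_of_calculus) (rule has_vector_derivative_at_within[OF der])
  ultimately show ?thesis
    unfolding circle_derivative_def periodic_2pi_def by (intro conjI exI[of _ f]) auto
qed

definition I_set :: "int \<Rightarrow> nat \<Rightarrow> int set" where
  "I_set N1 m0 = {n. N1 \<le> n \<and> n \<le> N1 + 2 * int m0 - 1}"

text \<open>\<open>v_entry\<close> and \<open>w\<close> use the indices 1, ..., \<open>2 * m0\<close>; matrices are indexed from 0.\<close>

definition v_entry :: "int \<Rightarrow> (nat \<Rightarrow> real) \<Rightarrow> nat \<Rightarrow> nat \<Rightarrow> complex" where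
  "v_entry N1 t k j =
     (let p = (j + 1) div 2; \<omega> = N1 + int k - 1
      in if odd j then cis (of_int \<omega> * t p) else \<i> * of_int \<omega> * cis (of_int \<omega> * t p))"

definition H_mat :: "int \<Rightarrow> nat \<Rightarrow> (nat \<Rightarrow> real) \<Rightarrow> complex Matrix.mat" where
  "H_mat N1 m0 t = Matrix.mat (2 * m0) (2 * m0) (\<lambda>(k, j). v_entry N1 t (k + 1) (j + 1))"

definition w :: "int \<Rightarrow> nat \<Rightarrow> (nat \<Rightarrow> real) \<Rightarrow> nat \<Rightarrow> nat \<Rightarrow> complex" where
  "w N1 m0 t j k = the (mat_inverse (H_mat N1 m0 t)) $$ (j - 1, k - 1)"

definition \<phi> :: "int \<Rightarrow> nat \<Rightarrow> (nat \<Rightarrow> real) \<Rightarrow> nat \<Rightarrow> real \<Rightarrow> complex" where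
  "\<phi> N1 m0 t p x =
     (\<Sum>k=1..2 * m0. w N1 m0 t (2 * p) k * cis (of_int (N1 + int k - 1) * x))"

definition \<psi> :: "int \<Rightarrow> nat \<Rightarrow> (nat \<Rightarrow> real) \<Rightarrow> nat \<Rightarrow> real \<Rightarrow> complex" where
  "\<psi> N1 m0 t p x =
     (\<Sum>k=1..2 * m0. w N1 m0 t (2 * p - 1) k * cis (of_int (N1 + int k - 1) * x))"

text \<open>The operator takes a function \<open>g\<close> together with its derivative \<open>g'\<close>.\<close>

definition reconstruct ::
    "int \<Rightarrow> nat \<Rightarrow> (nat \<Rightarrow> real) \<Rightarrow> (real \<Rightarrow> complex) \<Rightarrow> (real \<Rightarrow> complex) \<Rightarrow> real \<Rightarrow> complex" where
  "reconstruct N1 m0 t g g' x =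
     (\<Sum>p=1..m0. g (t p) * \<psi> N1 m0 t p x + g' (t p) * \<phi> N1 m0 t p x)"

definition shift :: "real \<Rightarrow> (real \<Rightarrow> complex) \<Rightarrow> real \<Rightarrow> complex" where
  "shift \<tau> f x = f (x - \<tau>)"

definition averaged_error ::
    "int \<Rightarrow> nat \<Rightarrow> (nat \<Rightarrow> real) \<Rightarrow> (real \<Rightarrow> complex) \<Rightarrow> (real \<Rightarrow> complex) \<Rightarrow> ennreal" where
  "averaged_error N1 m0 t f f' = ennreal_sqrt
     (ennreal (1 / (2 * pi)) *
      (\<integral>\<^sup>+ \<tau>\<in>{0..2 * pi}.
         (norm2 (\<lambda>x. shift \<tau> f x - reconstruct N1 m0 t (shift \<tau> f) (shift \<tau> f') x))\<^sup>2 \<partial>lebesgue))"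

definition Er :: "int \<Rightarrow> nat \<Rightarrow> (nat \<Rightarrow> real) \<Rightarrow> int \<Rightarrow> real" where
  "Er N1 m0 t n = 1 + (\<Sum>k=1..2 * m0. (cmod (\<Sum>p=1..m0.
     cis (of_int n * t p) * w N1 m0 t (2 * p - 1) k +
     \<i> * of_int n * cis (of_int n * t p) * w N1 m0 t (2 * p) k))\<^sup>2)"

end

theory Submission
  imports Defs "Jordan_Normal_Form.Determinant"
begin

text \<open>For fixed \<open>\<tau>\<close>, Parseval's identity splits the squared error into the energy of \<open>f\<close> outside
  \<open>I\<^sup>N\<close>, which does not depend on \<open>\<tau>\<close>, and the \<open>2 * m0\<close> terms \<open>|a(\<omega>\<^sub>k) cis (- \<omega>\<^sub>k \<tau>) - c\<^sub>k(\<tau>)|\<^sup>2\<close>,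
  where \<open>c\<^sub>k(\<tau>)\<close> is a combination of the samples \<open>f(t\<^sub>p - \<tau>)\<close> and \<open>f'(t\<^sub>p - \<tau>)\<close>. A second use of
  Parseval's identity, now in \<open>\<tau>\<close>, evaluates the average of these terms; the frequencies in \<open>I\<^sup>N\<close>
  drop out because the operator reproduces them. As \<open>f'\<close> may be only Henstock-Kurzweil integrable,
  Parseval's identity is needed as an identity between possibly infinite quantities: an HK-integrable
  function is square integrable if and only if its Fourier coefficients, defined through its indefinite
  integral, are square summable.\<close>

subsection \<open>Integration by parts and Fourier coefficients\<close>

text \<open>The operator samples \<open>f\<close> pointwise, although the values of \<open>f\<close>
  on a null set are arbitrary. Averaging over \<open>\<tau>\<close> repairs this: \<open>f\<close>
  has a continuous periodic representative \<open>F\<close>, and for almost every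
  \<open>\<tau>\<close> the finitely many samples of \<open>f\<close> and of \<open>F\<close> agree.
  The computation is therefore done with \<open>F\<close>, whose coefficients are the
  \<open>a(n)\<close>.

  As functions of \<open>\<tau>\<close> the samples are reflected translates of \<open>F\<close> and
  \<open>f'\<close>. Hence the coefficient of \<open>c\<^sub>k\<close> at frequency
  \<open>- n\<close> is \<open>a(n)\<close> times the response of the operator to the exponential of
  frequency \<open>n\<close>. Inverting the matrix makes this response a Kronecker delta on
  \<open>I\<^sup>N\<close>, and its single nonzero value is cancelled by the subtracted exponential.

  The two halves of the extended Parseval identity have different sources. A finite square integral
  forces absolute integrability; then integration by parts shows that the formal coefficients are
  the true ones, and Bessel's inequality applies. The other half is inherited from continuous
  functions, for which it comes from Stone-Weierstrass on the circle.\<close>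

lemma abs_integrable_mult_continuous:
  fixes d e :: "real \<Rightarrow> complex"
  assumes "d absolutely_integrable_on {a..b}" "continuous_on {a..b} e"
  shows "(\<lambda>x. d x * e x) absolutely_integrable_on {a..b}"
proof -
  have "(\<lambda>x. e x * d x) absolutely_integrable_on {a..b}"
  proof (rule absolutely_integrable_bounded_measurable_product[OF bilinear_times])
    show "e \<in> borel_measurable (lebesgue_on {a..b})"
      using assms(2) by (intro continuous_imp_measurable_on_sets_lebesgue) auto
    show "bounded (e ` {a..b})"
      using assms(2) by (intro compact_imp_bounded compact_continuous_image) auto
  qed (use assms in auto)
  then show ?thesis by (simp add: mult.commute)
qed

lemma integral_split:
  fixes f :: "real \<Rightarrow> complex"
  assumes "f integrable_on {a..b}" "a \<le> u" "u \<le> v" "v \<le> b"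
  shows "integral {a..v} f - integral {a..u} f = integral {u..v} f"
proof -
  have "f integrable_on {a..v}"
    using assms by (auto intro: integrable_on_subinterval)
  then show ?thesis
    using Henstock_Kurzweil_Integration.integral_combine[of a u v f] assms by (simp add: algebra_simps)
qed

text \<open>The defect of the formula is an additive interval function of size \<open>O((v - u) * \<integral>|d|)\<close> on
  \<open>{u..v}\<close>, hence zero: no differentiability of \<open>P\<close> is needed.\<close>

lemma integral_by_parts_indefinite:
  fixes d P e e' :: "real \<Rightarrow> complex"
  assumes d: "d absolutely_integrable_on {a..b}" and ab: "a \<le> b"
    and P: "\<And>u v. a \<le> u \<Longrightarrow> u \<le> v \<Longrightarrow> v \<le> b \<Longrightarrow> (d has_integral P v - P u) {u..v}"
    and e: "\<And>x. (e has_vector_derivative e' x) (at x)"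
    and e': "continuous_on UNIV e'"
    and L: "\<And>x. norm (e' x) \<le> L"
  shows "integral {a..b} (\<lambda>x. d x * e x) = P b * e b - P a * e a - integral {a..b} (\<lambda>x. P x * e' x)"
proof -
  have ce: "continuous_on S e" for S
    using e by (meson continuous_at_imp_continuous_on has_vector_derivative_continuous)
  have ce': "continuous_on S e'" for S
    using e' continuous_on_subset by blast
  have di: "d integrable_on {a..b}"
    using d set_lebesgue_integral_eq_integral(1) by blast
  have cP: "continuous_on {a..b} P"
  proof -
    have "continuous_on {a..b} (\<lambda>x. P a + integral {a..x} d)"
      by (intro continuous_intros indefinite_integral_continuous_1 di)
    moreover have "P a + integral {a..x} d = P x" if "x \<in> {a..b}" for x
      using P[of a x] that by (simp add: integral_unique)
    ultimately show ?thesis by (subst continuous_on_cong[OF refl, of _ P "\<lambda>x. P a + integral {a..x} d"]) auto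
  qed
  have L0: "0 \<le> L"
    using L[of 0] norm_ge_zero order_trans by blast
  have elip: "norm (e x - e u) \<le> L * (v - u)" if "u \<le> x" "x \<le> v" for u x v
  proof -
    have "(e' has_integral e x - e u) {u..x}"
      using that by (intro fundamental_theorem_of_calculus) (auto intro: has_vector_derivative_at_within e)
    then have "norm (e x - e u) \<le> L * (x - u)"
      using has_integral_bound_real[of L "{}" e' "e x - e u" u x] L0 L that by auto
    also have "\<dots> \<le> L * (v - u)" using that L0 by (simp add: mult_left_mono)
    finally show ?thesis .
  qed
  \<comment> \<open>The defect of the formula on \<open>{a..x}\<close>, up to the constant
    \<open>P a * e a\<close>; the claim is \<open>\<Phi> b = \<Phi> a\<close>.\<close>
  define \<Phi> where "\<Phi> x = integral {a..x} (\<lambda>x. d x * e x) - P x * e x + integral {a..x} (\<lambda>x. P x * e' x)" for x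
  define V where "V x = integral {a..x} (\<lambda>x. norm (d x))" for x
  have nd: "(\<lambda>x. norm (d x)) integrable_on {a..b}"
    using d absolutely_integrable_on_def by blast
  have inc: "norm (\<Phi> v - \<Phi> u) \<le> 2 * L * (v - u) * (V v - V u)" if uv: "a \<le> u" "u \<le> v" "v \<le> b" for u v
  proof -
    have sub: "{u..v} \<subseteq> {a..b}" using uv by auto
    have W: "V v - V u = integral {u..v} (\<lambda>x. norm (d x))"
      unfolding V_def using Henstock_Kurzweil_Integration.integral_combine[of a u v "\<lambda>x. norm (d x)"] uv
        integrable_on_subinterval[OF nd, of a v] by auto
    have nd': "(\<lambda>x. norm (d x)) integrable_on {u..v}"
      using nd sub by (rule integrable_on_subinterval)
    have d': "d absolutely_integrable_on {u..v}"
      using d sub by (meson absolutely_integrable_on_subinterval)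
    have de: "(\<lambda>x. d x * e x) integrable_on {a..b}"
      using abs_integrable_mult_continuous[OF d ce] set_lebesgue_integral_eq_integral(1) by blast
    have Pe: "(\<lambda>x. P x * e' x) integrable_on {a..b}"
      by (intro integrable_continuous_real continuous_intros cP ce')
    have duv: "(d has_integral P v - P u) {u..v}" using P uv by auto
    have euv: "(e' has_integral e v - e u) {u..v}"
      using uv by (intro fundamental_theorem_of_calculus) (auto intro: has_vector_derivative_at_within e)
    have de1: "(\<lambda>x. d x * (e x - e u)) integrable_on {u..v}"
      by (intro set_lebesgue_integral_eq_integral(1) abs_integrable_mult_continuous d' continuous_intros ce)
    have e1: "integral {u..v} (\<lambda>x. d x * (e x - e u)) = integral {u..v} (\<lambda>x. d x * e x) - (P v - P u) * e u"
    proof -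
      have "((\<lambda>x. d x * e x - d x * e u) has_integral integral {u..v} (\<lambda>x. d x * e x) - (P v - P u) * e u) {u..v}"
        using integrable_on_subinterval[OF de sub] duv
        by (intro has_integral_diff has_integral_mult_left integrable_integral)
      then show ?thesis by (simp add: algebra_simps integral_unique)
    qed
    have e2: "integral {u..v} (\<lambda>x. (P x - P v) * e' x) = integral {u..v} (\<lambda>x. P x * e' x) - P v * (e v - e u)"
    proof -
      have "((\<lambda>x. P x * e' x - P v * e' x) has_integral integral {u..v} (\<lambda>x. P x * e' x) - P v * (e v - e u)) {u..v}"
        using integrable_on_subinterval[OF Pe sub] euv
        by (intro has_integral_diff has_integral_mult_right integrable_integral)
      then show ?thesis by (simp add: algebra_simps integral_unique)
    qed
    \<comment> \<open>Freezing \<open>e\<close> at the left end and \<open>P\<close> at the right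
      end makes all boundary terms cancel. Each remaining integral contains two small factors: the
      length \<open>v - u\<close>, and the variation of the primitive, measured by
      \<open>V v - V u\<close>.\<close>
    have eq: "\<Phi> v - \<Phi> u = integral {u..v} (\<lambda>x. d x * (e x - e u)) + integral {u..v} (\<lambda>x. (P x - P v) * e' x)"
      unfolding \<Phi>_def e1 e2 integral_split[OF de uv, symmetric] integral_split[OF Pe uv, symmetric]
      by (simp add: algebra_simps)
    have b1: "norm (integral {u..v} (\<lambda>x. d x * (e x - e u))) \<le> integral {u..v} (\<lambda>x. norm (d x) * (L * (v - u)))"
      by (intro integral_norm_bound_integral de1 integrable_on_mult_left nd')
         (auto simp: norm_mult intro!: mult_left_mono elip)
    have b2: "norm (integral {u..v} (\<lambda>x. (P x - P v) * e' x)) \<le> (V v - V u) * L * (v - u)"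
    proof -
      have "norm (P x - P v) \<le> V v - V u" if x: "x \<in> {u..v}" for x
      proof -
        have nx: "(\<lambda>x. norm (d x)) integrable_on {x..v}"
          using x nd' by (auto intro: integrable_on_subinterval)
        have dx: "(d has_integral P v - P x) {x..v}" using P uv x by auto
        have "norm (P v - P x) \<le> integral {x..v} (\<lambda>x. norm (d x))"
          using integral_norm_bound_integral[of d "{x..v}" "\<lambda>x. norm (d x)"] nx dx
          by (auto simp: integral_unique has_integral_integrable)
        also have "\<dots> \<le> integral {u..v} (\<lambda>x. norm (d x))"
          using x nx nd' by (intro integral_subset_le) auto
        finally show ?thesis using W by (simp add: norm_minus_commute)
      qed
      then have "norm ((P x - P v) * e' x) \<le> (V v - V u) * L" if "x \<in> {u..v}" for x
        unfolding norm_mult using that order_trans[OF norm_ge_zero] by (intro mult_mono L) blast+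
      moreover have "continuous_on {u..v} (\<lambda>x. (P x - P v) * e' x)"
        by (intro continuous_intros ce' continuous_on_subset[OF cP sub])
      ultimately show ?thesis
        using integral_bound[of u v "\<lambda>x. (P x - P v) * e' x" "(V v - V u) * L"] uv by auto
    qed
    have "norm (\<Phi> v - \<Phi> u) \<le> norm (integral {u..v} (\<lambda>x. d x * (e x - e u))) + norm (integral {u..v} (\<lambda>x. (P x - P v) * e' x))"
      unfolding eq by (rule norm_triangle_ineq)
    also have "\<dots> \<le> (V v - V u) * (L * (v - u)) + (V v - V u) * L * (v - u)"
      using b1 b2 by (intro add_mono) (simp_all only: Henstock_Kurzweil_Integration.integral_mult_left W)
    also have "\<dots> = 2 * L * (v - u) * (V v - V u)" by (simp add: algebra_simps)
    finally show ?thesis .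
  qed
  \<comment> \<open>Over \<open>Suc n\<close> equal pieces the lengths contribute the factor
    \<open>(b - a) / Suc n\<close>, while the increments of \<open>V\<close> telescope to a
    constant.\<close>
  have "norm (\<Phi> b - \<Phi> a) \<le> (2 * L * (b - a) * (V b - V a)) / real (Suc n)" for n
  proof -
    define s where "s i = a + (b - a) * real i / real (Suc n)" for i
    have step: "s (Suc i) - s i = (b - a) / real (Suc n)" for i
      unfolding s_def by (simp add: diff_divide_distrib[symmetric] right_diff_distrib[symmetric])
    have ends: "s 0 = a" "s (Suc n) = b"
      unfolding s_def by (simp_all del: of_nat_Suc)
    have "norm (\<Phi> b - \<Phi> a) = norm (\<Sum>i<Suc n. \<Phi> (s (Suc i)) - \<Phi> (s i))"
      by (subst sum_lessThan_telescope) (simp only: ends)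
    also have "\<dots> \<le> (\<Sum>i<Suc n. norm (\<Phi> (s (Suc i)) - \<Phi> (s i)))" by (rule norm_sum)
    also have "\<dots> \<le> (\<Sum>i<Suc n. 2 * L * ((b - a) / real (Suc n)) * (V (s (Suc i)) - V (s i)))"
    proof (rule sum_mono)
      fix i assume i: "i \<in> {..<Suc n}"
      have "a \<le> s i" using ab by (simp add: s_def)
      moreover have "s i \<le> s (Suc i)" using step[of i] ab by (smt (verit) divide_nonneg_nonneg of_nat_0_le_iff)
      moreover have "s (Suc i) \<le> b"
      proof -
        have "(b - a) * (real (Suc i) / real (Suc n)) \<le> (b - a) * 1"
          using i ab by (intro mult_left_mono) (auto simp: divide_le_eq)
        then show ?thesis by (simp add: s_def)
      qed
      ultimately show "norm (\<Phi> (s (Suc i)) - \<Phi> (s i)) \<le> 2 * L * ((b - a) / real (Suc n)) * (V (s (Suc i)) - V (s i))"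
        using inc[of "s i" "s (Suc i)"] step[of i] by simp
    qed
    also have "\<dots> = 2 * L * ((b - a) / real (Suc n)) * (V (s (Suc n)) - V (s 0))"
      by (simp only: sum_distrib_left[symmetric] sum_lessThan_telescope[of "\<lambda>i. V (s i)"])
    also have "\<dots> = (2 * L * (b - a) * (V b - V a)) / real (Suc n)"
      by (simp add: ends)
    finally show ?thesis .
  qed
  moreover have "(\<lambda>n. (2 * L * (b - a) * (V b - V a)) / real (Suc n)) \<longlonglongrightarrow> 0"
    by (rule LIMSEQ_Suc[OF lim_const_over_n])
  ultimately have "norm (\<Phi> b - \<Phi> a) \<le> 0"
    by (intro LIMSEQ_le_const) auto
  then show ?thesis
    by (simp add: \<Phi>_def algebra_simps)
qed

text \<open>The gauge integral takes the place of the Lebesgue integral in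
  \<open>fourier_coeff\<close>, so that the \<open>has_integral\<close> calculus applies;
  \<open>fourier_coeff_eq_fc\<close> connects the two for a continuous representative.\<close>

definition fc :: "(real \<Rightarrow> complex) \<Rightarrow> int \<Rightarrow> complex" where
  "fc g n = integral {0..2 * pi} (\<lambda>x. g x * cis (- (of_int n * x))) / complex_of_real (2 * pi)"

lemma has_vector_derivative_cis_mult:
  "((\<lambda>x. cis (c * x)) has_vector_derivative \<i> * of_real c * cis (c * x)) (at x within S)"
  unfolding has_vector_derivative_def
  by (auto intro!: derivative_eq_intros simp: scaleR_conv_of_real)

lemma integral_cis:
  "((\<lambda>x. cis (of_int k * x)) has_integral (if k = 0 then complex_of_real (2 * pi) else 0)) {0..2 * pi}"
proof (cases "k = 0")
  case True
  then show ?thesis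
    using has_integral_const_real[of "1::complex" 0 "2*pi"] by (simp add: scaleR_conv_of_real)
next
  case False
  have "((\<lambda>x. cis (of_int k * x)) has_integral cis (of_int k * (2 * pi)) / (\<i> * of_int k) - cis (of_int k * 0) / (\<i> * of_int k)) {0..2 * pi}"
    by (intro fundamental_theorem_of_calculus)
       (use False has_vector_derivative_cis_mult[of "of_int k"] in
         \<open>auto intro!: derivative_eq_intros\<close>)
  moreover have "cis (of_int k * (2 * pi)) = 1"
    by (metis cis_multiple_2pi Ints_of_int mult.commute)
  ultimately show ?thesis using False by simp
qed

subsection \<open>Parseval's identity for continuous functions\<close>

lemma fc_has_integral:
  assumes "g absolutely_integrable_on {0..2 * pi}"
  shows "((\<lambda>x. g x * cis (- (of_int n * x))) has_integral complex_of_real (2 * pi) * fc g n) {0..2 * pi}"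
proof -
  have "(\<lambda>x. g x * cis (- (of_int n * x))) integrable_on {0..2 * pi}"
    by (intro set_lebesgue_integral_eq_integral(1) abs_integrable_mult_continuous assms continuous_intros)
  then show ?thesis by (simp add: fc_def integrable_integral)
qed

lemma continuous_abs_integrable:
  fixes g :: "real \<Rightarrow> complex"
  shows "continuous_on {a..b} g \<Longrightarrow> g absolutely_integrable_on {a..b}"
  by (simp add: absolutely_integrable_continuous_real)

lemma fc_add:
  assumes "g absolutely_integrable_on {0..2 * pi}" "h absolutely_integrable_on {0..2 * pi}"
  shows "fc (\<lambda>x. g x + h x) n = fc g n + fc h n"
proof -
  have "((\<lambda>x. (g x + h x) * cis (- (of_int n * x))) has_integral
      complex_of_real (2 * pi) * fc g n + complex_of_real (2 * pi) * fc h n) {0..2 * pi}"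
    using has_integral_add[OF fc_has_integral[OF assms(1)] fc_has_integral[OF assms(2)]]
    by (simp add: algebra_simps)
  then show ?thesis
    by (simp add: fc_def[of "\<lambda>x. g x + h x"] integral_unique add_divide_distrib)
qed

lemma fc_cmult: "fc (\<lambda>x. c * g x) n = c * fc g n"
  unfolding fc_def by (simp add: mult.assoc)

lemma fc_cis: "fc (\<lambda>x. cis (of_int m * x)) n = (if m = n then 1 else 0)"
proof -
  have "(\<lambda>x. cis (of_int m * x) * cis (- (of_int n * x))) = (\<lambda>x. cis (of_int (m - n) * x))"
    by (auto simp: cis_mult algebra_simps)
  then show ?thesis
    using integral_unique[OF integral_cis[of "m - n"]] unfolding fc_def by auto
qed

lemma fc_sum:
  assumes "finite A" "\<And>i. i \<in> A \<Longrightarrow> g i absolutely_integrable_on {0..2 * pi}"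
  shows "fc (\<lambda>x. \<Sum>i\<in>A. g i x) n = (\<Sum>i\<in>A. fc (g i) n)"
  using assms
proof (induction A rule: finite_induct)
  case empty
  then show ?case by (simp add: fc_def)
next
  case (insert i A)
  have "(\<lambda>x. \<Sum>i\<in>A. g i x) absolutely_integrable_on {0..2 * pi}"
    using insert by (intro absolutely_integrable_sum) auto
  then show ?case using insert by (simp add: fc_add)
qed

lemma fc_trig_sum:
  assumes "finite A"
  shows "fc (\<lambda>x. \<Sum>m\<in>A. c m * cis (of_int m * x)) n = (if n \<in> A then c n else 0)"
proof -
  have "fc (\<lambda>x. \<Sum>m\<in>A. c m * cis (of_int m * x)) n = (\<Sum>m\<in>A. c m * (if m = n then 1 else 0))"
    by (subst fc_sum[OF assms]) (auto intro!: continuous_abs_integrable continuous_intros sum.cong simp: fc_cmult fc_cis)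
  also have "\<dots> = (if n \<in> A then c n else 0)"
    using assms by (simp add: if_distrib sum.delta cong: if_cong)
  finally show ?thesis .
qed

text \<open>The inner product of \<open>g\<close> with a trigonometric polynomial. Its real part is
  what the expansion of a squared distance contains.\<close>

lemma has_integral_cnj_trig_sum:
  assumes g: "g absolutely_integrable_on {0..2 * pi}" and A: "finite A"
  shows "((\<lambda>x. Re (g x * cnj (\<Sum>m\<in>A. c m * cis (of_int m * x)))) has_integral
      2 * pi * (\<Sum>m\<in>A. Re (fc g m * cnj (c m)))) {0..2 * pi}"
proof -
  have "((\<lambda>x. \<Sum>m\<in>A. cnj (c m) * (g x * cis (- (of_int m * x)))) has_integral
      (\<Sum>m\<in>A. cnj (c m) * (complex_of_real (2 * pi) * fc g m))) {0..2 * pi}"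
    by (intro has_integral_sum A has_integral_mult_right fc_has_integral g)
  from has_integral_linear[OF this bounded_linear_Re]
  have "((\<lambda>x. Re (\<Sum>m\<in>A. cnj (c m) * (g x * cis (- (of_int m * x))))) has_integral
      Re (\<Sum>m\<in>A. cnj (c m) * (complex_of_real (2 * pi) * fc g m))) {0..2 * pi}"
    by (simp add: o_def)
  moreover have "(\<Sum>m\<in>A. cnj (c m) * (g x * cis (- (of_int m * x)))) = g x * cnj (\<Sum>m\<in>A. c m * cis (of_int m * x))" for x
    by (simp add: cis_cnj sum_distrib_left mult_ac)
  moreover have "Re (\<Sum>m\<in>A. cnj (c m) * (complex_of_real (2 * pi) * fc g m)) = 2 * pi * (\<Sum>m\<in>A. Re (fc g m * cnj (c m)))"
  proof -
    have "(\<Sum>m\<in>A. cnj (c m) * (complex_of_real (2 * pi) * fc g m)) = of_real (2 * pi) * (\<Sum>m\<in>A. fc g m * cnj (c m))"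
      by (simp add: sum_distrib_left mult_ac)
    moreover have "Re (of_real r * z) = r * Re z" for r z by simp
    ultimately show ?thesis by (simp only: Re_sum)
  qed
  ultimately show ?thesis by simp
qed

text \<open>Expanding the square and completing it again in the coefficients. Arbitrary
  \<open>c\<close> are allowed because the formula has two uses: \<open>c = fc g\<close> yields
  Bessel's inequality, and the coefficients of a uniform approximation yield its converse for
  continuous functions.\<close>

lemma norm_diff_trig_sum_has_integral:
  assumes g: "g absolutely_integrable_on {0..2 * pi}" and A: "finite A"
    and I: "((\<lambda>x. (cmod (g x))\<^sup>2) has_integral I) {0..2 * pi}"
  shows "((\<lambda>x. (cmod (g x - (\<Sum>m\<in>A. c m * cis (of_int m * x))))\<^sup>2) has_integral
      I + 2 * pi * (\<Sum>m\<in>A. (cmod (c m - fc g m))\<^sup>2 - (cmod (fc g m))\<^sup>2)) {0..2 * pi}"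
proof -
  define S where "S x = (\<Sum>m\<in>A. c m * cis (of_int m * x))" for x
  have S: "S absolutely_integrable_on {0..2 * pi}"
    unfolding S_def by (intro continuous_abs_integrable continuous_intros)
  have "((\<lambda>x. Re (S x * cnj (S x))) has_integral 2 * pi * (\<Sum>m\<in>A. Re (c m * cnj (c m)))) {0..2 * pi}"
    using has_integral_cnj_trig_sum[OF S A, of c]
    by (simp add: S_def[symmetric] fc_trig_sum[OF A, of c, folded S_def] del: complex_cnj_cnj times_complex.sel cong: sum.cong)
  then have S2: "((\<lambda>x. (cmod (S x))\<^sup>2) has_integral 2 * pi * (\<Sum>m\<in>A. (cmod (c m))\<^sup>2)) {0..2 * pi}"
    by (simp only: complex_mult_cnj Re_complex_of_real cmod_power2)
  have gS: "((\<lambda>x. Re (g x * cnj (S x))) has_integral 2 * pi * (\<Sum>m\<in>A. Re (fc g m * cnj (c m)))) {0..2 * pi}"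
    using has_integral_cnj_trig_sum[OF g A, of c] unfolding S_def .
  have ident: "(cmod (u - v))\<^sup>2 = (cmod u)\<^sup>2 - 2 * Re (u * cnj v) + (cmod v)\<^sup>2" for u v
    unfolding cmod_power2 by (simp add: power2_eq_square algebra_simps)
  have "((\<lambda>x. (cmod (g x - S x))\<^sup>2) has_integral
      (I - 2 * (2 * pi * (\<Sum>m\<in>A. Re (fc g m * cnj (c m)))) + 2 * pi * (\<Sum>m\<in>A. (cmod (c m))\<^sup>2))) {0..2 * pi}"
    unfolding ident by (intro has_integral_add has_integral_diff I gS S2 has_integral_mult_right)
  moreover have eq: "(\<Sum>m\<in>A. (cmod (c m - fc g m))\<^sup>2 - (cmod (fc g m))\<^sup>2) =
      (\<Sum>m\<in>A. (cmod (c m))\<^sup>2) - 2 * (\<Sum>m\<in>A. Re (fc g m * cnj (c m)))"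
  proof -
    have "(cmod (c m - fc g m))\<^sup>2 - (cmod (fc g m))\<^sup>2 = (cmod (c m))\<^sup>2 - 2 * Re (fc g m * cnj (c m))" for m
      by (simp add: ident mult.commute)
    then show ?thesis by (simp add: sum_subtractf sum_distrib_left)
  qed
  moreover have "I + 2 * pi * (\<Sum>m\<in>A. (cmod (c m - fc g m))\<^sup>2 - (cmod (fc g m))\<^sup>2) =
      I - 2 * (2 * pi * (\<Sum>m\<in>A. Re (fc g m * cnj (c m)))) + 2 * pi * (\<Sum>m\<in>A. (cmod (c m))\<^sup>2)"
    unfolding eq by (simp only: right_diff_distrib mult_ac)
  ultimately show ?thesis by (simp only: S_def)
qed

lemma bessel:
  assumes g: "g absolutely_integrable_on {0..2 * pi}" and A: "finite A"
    and I: "((\<lambda>x. (cmod (g x))\<^sup>2) has_integral I) {0..2 * pi}"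
  shows "2 * pi * (\<Sum>m\<in>A. (cmod (fc g m))\<^sup>2) \<le> I"
proof -
  from norm_diff_trig_sum_has_integral[OF assms, of "fc g"]
  have "0 \<le> I + 2 * pi * (\<Sum>m\<in>A. (cmod (fc g m - fc g m))\<^sup>2 - (cmod (fc g m))\<^sup>2)"
    by (rule has_integral_nonneg) auto
  then show ?thesis by (simp add: sum_negf)
qed

section \<open>Density of trigonometric polynomials and Parseval's identity\<close>

text \<open>Generated by monomials and sums, so that closure under products is a rule induction;
  \<open>trig_poly_sum\<close> recovers the explicit finite sum.\<close>

inductive trig_poly :: "(real \<Rightarrow> complex) \<Rightarrow> bool" where
  cis: "trig_poly (\<lambda>x. c * cis (of_int n * x))"
| add: "trig_poly g \<Longrightarrow> trig_poly h \<Longrightarrow> trig_poly (\<lambda>x. g x + h x)"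

lemma trig_poly_cmult: "trig_poly g \<Longrightarrow> trig_poly (\<lambda>x. b * g x)"
proof (induction rule: trig_poly.induct)
  case (cis c n)
  then show ?case using trig_poly.cis[of "b * c" n] by (simp add: mult.assoc)
next
  case (add g h)
  then show ?case using trig_poly.add[OF add.IH] by (simp add: distrib_left)
qed

lemma trig_poly_cis_mult: "trig_poly g \<Longrightarrow> trig_poly (\<lambda>x. c * cis (of_int n * x) * g x)"
proof (induction rule: trig_poly.induct)
  case (cis b m)
  have "(\<lambda>x. c * cis (of_int n * x) * (b * cis (of_int m * x))) = (\<lambda>x. (c * b) * cis (of_int (n + m) * x))"
    by (auto simp: algebra_simps cis_mult)
  then show ?case using trig_poly.cis[of "c * b" "n + m"] by simp
next
  case (add g h)
  then show ?case using trig_poly.add[OF add.IH] by (simp add: distrib_left)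
qed

lemma trig_poly_mult: "trig_poly g \<Longrightarrow> trig_poly h \<Longrightarrow> trig_poly (\<lambda>x. g x * h x)"
proof (induction rule: trig_poly.induct)
  case (cis c n)
  then show ?case by (rule trig_poly_cis_mult)
next
  case (add g1 g2)
  then show ?case using trig_poly.add[OF add.IH] by (simp add: distrib_right)
qed

lemma trig_poly_const: "trig_poly (\<lambda>x. c)"
  using trig_poly.cis[of c 0] by simp

text \<open>Stone-Weierstrass supplies real polynomial functions on the plane. On the circle a
  linear \<open>h\<close> becomes \<open>cos x * h 1 + sin x * h \<i>\<close>, a combination of
  \<open>cis x\<close> and \<open>cis (- x)\<close>; the other cases are closure properties.\<close>

lemma trig_poly_real_polynomial_function:
  assumes "real_polynomial_function (p :: complex \<Rightarrow> real)"
  shows "trig_poly (\<lambda>x. of_real (p (cis x)))"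
  using assms
proof (induction rule: real_polynomial_function.induct)
  case (linear h)
  have "of_real (h (cis x)) = (of_real (h 1) - \<i> * of_real (h \<i>)) / 2 * cis (of_int 1 * x)
      + (of_real (h 1) + \<i> * of_real (h \<i>)) / 2 * cis (of_int (-1) * x)" for x
  proof -
    have "cis x = cos x *\<^sub>R 1 + sin x *\<^sub>R \<i>" by (simp add: complex_eq_iff)
    then have "h (cis x) = cos x * h 1 + sin x * h \<i>"
      using linear by (simp only: linear_simps) simp
    then show ?thesis by (simp add: complex_eq_iff algebra_simps add_divide_distrib diff_divide_distrib)
  qed
  then show ?case
    by (simp only:) (rule trig_poly.add[OF trig_poly.cis trig_poly.cis])
qed (auto intro: trig_poly_const trig_poly.add trig_poly_mult)

text \<open>The coefficients vanish off \<open>A\<close> so that two sums can be extended to the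
  common index set \<open>A \<union> B\<close> and added.\<close>

lemma trig_poly_sum:
  "trig_poly T \<Longrightarrow> \<exists>A c. finite A \<and> (\<forall>n. n \<notin> A \<longrightarrow> c n = 0) \<and> T = (\<lambda>x. \<Sum>n\<in>A. c n * cis (of_int n * x))"
proof (induction rule: trig_poly.induct)
  case (cis c n)
  show ?case
    by (intro exI[of _ "{n}"] exI[of _ "\<lambda>m. if m = n then c else 0"]) auto
next
  case (add g h)
  then obtain A a B b where A: "finite A" "\<And>n. n \<notin> A \<Longrightarrow> a n = 0" "g = (\<lambda>x. \<Sum>n\<in>A. a n * cis (of_int n * x))"
    and B: "finite B" "\<And>n. n \<notin> B \<Longrightarrow> b n = 0" "h = (\<lambda>x. \<Sum>n\<in>B. b n * cis (of_int n * x))"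
    by auto
  have "g x + h x = (\<Sum>n\<in>A \<union> B. (a n + b n) * cis (of_int n * x))" for x
  proof -
    have "g x = (\<Sum>n\<in>A \<union> B. a n * cis (of_int n * x))"
      unfolding A(3) using A B by (intro sum.mono_neutral_left) auto
    moreover have "h x = (\<Sum>n\<in>A \<union> B. b n * cis (of_int n * x))"
      unfolding B(3) using A B by (intro sum.mono_neutral_left) auto
    ultimately show ?thesis by (simp add: sum.distrib distrib_right)
  qed
  then show ?case
    using A B by (intro exI[of _ "A \<union> B"] exI[of _ "\<lambda>n. a n + b n"]) auto
qed

lemma periodic_cis_eq:
  assumes "periodic_2pi g" "cis x = cis y"
  shows "g x = g y"
proof -
  have nat: "g (x + 2 * pi * real n) = g x" for x n
  proof (induction n)
    case (Suc n)
    have "x + 2 * pi * real (Suc n) = (x + 2 * pi * real n) + 2 * pi" by (simp add: algebra_simps)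
    then show ?case using Suc assms(1) unfolding periodic_2pi_def by metis
  qed simp
  obtain k :: int where k: "x = y + 2 * pi * of_int k"
  proof -
    have "sin x = sin y \<and> cos x = cos y"
      using assms(2) by (simp add: complex_eq_iff)
    then obtain k :: int where "x = y + 2 * pi * of_int k"
      using sin_cos_eq_iff by blast
    then show ?thesis using that by blast
  qed
  show ?thesis
  proof (cases "k \<ge> 0")
    case True
    then show ?thesis using nat[of y "nat k"] k by simp
  next
    case False
    then have "y = x + 2 * pi * real (nat (- k))" using k by simp
    then show ?thesis using nat[of x "nat (- k)"] by simp
  qed
qed

text \<open>Passing to the compact circle makes Stone-Weierstrass applicable. The factor is
  \<open>g\<close> composed with \<open>Arg\<close>, and only the jump of \<open>Arg\<close> needs
  care.\<close>

lemma periodic_factor: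
  fixes g :: "real \<Rightarrow> complex"
  assumes "periodic_2pi g" "continuous_on UNIV g"
  obtains G where "continuous_on (sphere 0 1) G" "\<And>x. g x = G (cis x)"
proof
  have cg: "isCont g x" for x
    using assms(2) by (simp add: continuous_on_eq_continuous_at)
  \<comment> \<open>\<open>Arg (- z) + pi\<close> is another argument of \<open>z\<close>, and it is
    continuous where \<open>Arg\<close> jumps, on the negative real axis.\<close>
  have eq: "g (Arg z) = g (Arg (- z) + pi)" if "z \<noteq> 0" for z
  proof (rule periodic_cis_eq[OF assms(1)])
    have "cis (Arg z) = sgn z" "cis (Arg (- z)) = sgn (- z)" using that by (auto simp: cis_Arg)
    then show "cis (Arg z) = cis (Arg (- z) + pi)" by (simp add: sgn_minus flip: cis_mult)
  qed
  have "isCont (\<lambda>z. g (Arg z)) z" if "z \<noteq> 0" for z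
  proof (cases "z \<in> \<real>\<^sub>\<le>\<^sub>0")
    case False
    then show ?thesis
      by (intro isCont_o2[OF continuous_at_Arg cg])
  next
    case True
    then have "- z \<notin> \<real>\<^sub>\<le>\<^sub>0"
      using that by (auto simp: complex_nonpos_Reals_iff complex_eq_iff)
    then have 1: "isCont (\<lambda>z. g (Arg (- z) + pi)) z"
      by (intro isCont_o2[OF _ cg] continuous_intros isCont_o2[OF _ continuous_at_Arg]) auto
    have "\<forall>\<^sub>F y in nhds z. g (Arg y) = g (Arg (- y) + pi)"
      using t1_space_nhds[OF that] by eventually_elim (rule eq)
    from isCont_cong[OF this] 1 show ?thesis by simp
  qed
  then show "continuous_on (sphere 0 1) (\<lambda>z. g (Arg z))"
    by (intro continuous_at_imp_continuous_on ballI) (metis norm_eq_zero mem_sphere_0 zero_neq_one)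
  fix x
  have "cis (Arg (cis x)) = cis x"
    by (subst cis_Arg) (auto simp: sgn_div_norm)
  then show "g x = g (Arg (cis x))"
    by (intro periodic_cis_eq[OF assms(1)]) simp
qed

lemma trig_poly_dense:
  fixes g :: "real \<Rightarrow> complex"
  assumes "periodic_2pi g" "continuous_on UNIV g" "0 < e"
  obtains T where "trig_poly T" "\<And>x. cmod (g x - T x) < e"
proof -
  obtain G where G: "continuous_on (sphere 0 1) G" "\<And>x. g x = G (cis x)"
    using periodic_factor assms by blast
  have "continuous_on (sphere 0 1) (\<lambda>z. Re (G z))" "continuous_on (sphere 0 1) (\<lambda>z. Im (G z))"
    by (intro continuous_intros G)+
  note ReIm = this
  obtain p where p: "real_polynomial_function p" "\<And>z. z \<in> sphere 0 1 \<Longrightarrow> \<bar>Re (G z) - p z\<bar> < e / 2"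
    using Stone_Weierstrass_real_polynomial_function[OF compact_sphere ReIm(1) half_gt_zero[OF assms(3)]] by blast
  obtain q where q: "real_polynomial_function q" "\<And>z. z \<in> sphere 0 1 \<Longrightarrow> \<bar>Im (G z) - q z\<bar> < e / 2"
    using Stone_Weierstrass_real_polynomial_function[OF compact_sphere ReIm(2) half_gt_zero[OF assms(3)]] by blast
  show ?thesis
  proof
    show "trig_poly (\<lambda>x. of_real (p (cis x)) + \<i> * of_real (q (cis x)))"
      by (intro trig_poly.add trig_poly_cmult trig_poly_real_polynomial_function p q)
    fix x
    have "cmod (g x - (of_real (p (cis x)) + \<i> * of_real (q (cis x)))) \<le> \<bar>Re (G (cis x)) - p (cis x)\<bar> + \<bar>Im (G (cis x)) - q (cis x)\<bar>"
      using cmod_le[of "g x - (of_real (p (cis x)) + \<i> * of_real (q (cis x)))"] by (simp add: G)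
    also have "\<dots> < e" using p(2)[of "cis x"] q(2)[of "cis x"] by (simp add: dist_norm)
    finally show "cmod (g x - (of_real (p (cis x)) + \<i> * of_real (q (cis x)))) < e" .
  qed
qed

lemma ennreal_infsum_eqI:
  fixes f :: "'a \<Rightarrow> real"
  assumes nn: "\<And>i. 0 \<le> f i" and le: "\<And>A. finite A \<Longrightarrow> sum f A \<le> L"
    and approx: "\<And>e. e > 0 \<Longrightarrow> \<exists>A. finite A \<and> L \<le> sum f A + e"
  shows "(\<Sum>\<^sub>\<infinity>i. ennreal (f i)) = ennreal L"
proof -
  have "(\<Sum>\<^sub>\<infinity>i. ennreal (f i)) = (SUP A\<in>{A. finite A}. ennreal (sum f A))"
    by (subst nonneg_infsum_complete) (auto simp: sum_ennreal nn)
  also have "\<dots> = ennreal L"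
  proof (rule antisym)
    show "(SUP A\<in>{A. finite A}. ennreal (sum f A)) \<le> ennreal L"
      by (intro SUP_least ennreal_leI le) auto
    show "ennreal L \<le> (SUP A\<in>{A. finite A}. ennreal (sum f A))"
    proof (rule ennreal_le_epsilon)
      fix e :: real assume "e > 0"
      with approx obtain A where A: "finite A" "L \<le> sum f A + e" by blast
      then have "ennreal L \<le> ennreal (sum f A) + ennreal e"
        using \<open>e > 0\<close> nn by (subst ennreal_plus[symmetric]) (auto intro!: ennreal_leI sum_nonneg)
      also have "\<dots> \<le> (SUP A\<in>{A. finite A}. ennreal (sum f A)) + ennreal e"
        using A by (intro add_right_mono SUP_upper) auto
      finally show "ennreal L \<le> (SUP A\<in>{A. finite A}. ennreal (sum f A)) + ennreal e" .
    qed
  qed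
  finally show ?thesis .
qed

text \<open>Bessel's inequality bounds the finite sums from above. For the converse, the
  coefficients of a uniformly close trigonometric polynomial are inserted into the formula for the
  squared distance.\<close>

theorem parseval_continuous:
  fixes g :: "real \<Rightarrow> complex"
  assumes per: "periodic_2pi g" and cont: "continuous_on UNIV g"
  shows "(\<Sum>\<^sub>\<infinity>n. ennreal ((cmod (fc g n))\<^sup>2)) = ennreal (integral {0..2 * pi} (\<lambda>x. (cmod (g x))\<^sup>2) / (2 * pi))"
proof (rule ennreal_infsum_eqI)
  have cg: "continuous_on S g" for S
    using cont continuous_on_subset by blast
  have g: "g absolutely_integrable_on {0..2 * pi}"
    by (intro continuous_abs_integrable cg)
  define I where "I = integral {0..2 * pi} (\<lambda>x. (cmod (g x))\<^sup>2)"
  have I: "((\<lambda>x. (cmod (g x))\<^sup>2) has_integral I) {0..2 * pi}"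
    unfolding I_def by (intro integrable_integral integrable_continuous_real continuous_intros cg)
  show "sum (\<lambda>n. (cmod (fc g n))\<^sup>2) A \<le> integral {0..2 * pi} (\<lambda>x. (cmod (g x))\<^sup>2) / (2 * pi)" if "finite A" for A
    using bessel[OF g that I] unfolding I_def[symmetric] by (simp add: field_simps)
  fix e :: real assume e: "e > 0"
  \<comment> \<open>The distance enters squared, so accuracy \<open>sqrt e\<close> gives mean square
    error at most \<open>e\<close>.\<close>
  obtain T where T: "trig_poly T" "\<And>x. cmod (g x - T x) < sqrt e"
    using trig_poly_dense[OF per cont, of "sqrt e"] e by auto
  then obtain A c where A: "finite A" "T = (\<lambda>x. \<Sum>n\<in>A. c n * cis (of_int n * x))"
    using trig_poly_sum by metis
  have "I + 2 * pi * (\<Sum>m\<in>A. (cmod (c m - fc g m))\<^sup>2 - (cmod (fc g m))\<^sup>2) \<le> e * (2 * pi)"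
  proof (rule has_integral_le[OF norm_diff_trig_sum_has_integral[OF g A(1) I]])
    show "((\<lambda>x. e) has_integral e * (2 * pi)) {0..2 * pi}"
      using has_integral_const_real[of e 0 "2 * pi"] by (simp add: mult.commute)
    fix x
    have "(cmod (g x - T x))\<^sup>2 \<le> (sqrt e)\<^sup>2"
      using T(2)[of x] by (intro power_mono) auto
    then show "(cmod (g x - (\<Sum>m\<in>A. c m * cis (of_int m * x))))\<^sup>2 \<le> e"
      using e by (simp add: A)
  qed
  \<comment> \<open>The distance between the coefficients of \<open>T\<close> and those of
    \<open>g\<close> is nonnegative and is discarded, so nothing about \<open>c\<close> has to be
    known.\<close>
  moreover have "(\<Sum>m\<in>A. - (cmod (fc g m))\<^sup>2) \<le> (\<Sum>m\<in>A. (cmod (c m - fc g m))\<^sup>2 - (cmod (fc g m))\<^sup>2)"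
    by (intro sum_mono) auto
  then have "2 * pi * - (\<Sum>m\<in>A. (cmod (fc g m))\<^sup>2) \<le>
      2 * pi * (\<Sum>m\<in>A. (cmod (c m - fc g m))\<^sup>2 - (cmod (fc g m))\<^sup>2)"
    unfolding sum_negf by (intro mult_left_mono) auto
  ultimately have "I \<le> e * (2 * pi) + 2 * pi * (\<Sum>m\<in>A. (cmod (fc g m))\<^sup>2)"
    by simp
  then have "I / (2 * pi) \<le> (\<Sum>m\<in>A. (cmod (fc g m))\<^sup>2) + e"
    by (simp add: field_simps)
  with A show "\<exists>A. finite A \<and> integral {0..2 * pi} (\<lambda>x. (cmod (g x))\<^sup>2) / (2 * pi) \<le> (\<Sum>m\<in>A. (cmod (fc g m))\<^sup>2) + e"
    unfolding I_def by blast
qed auto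

subsection \<open>Fourier coefficients through the indefinite integral\<close>

text \<open>Indefinite Henstock-Kurzweil integrals are continuous even when the integrand is not
  absolutely integrable. This provides the continuous representative of \<open>f\<close>.\<close>

lemma continuous_on_indefinite_integral_UNIV:
  fixes d D :: "real \<Rightarrow> complex"
  assumes D: "\<And>a b. a \<le> b \<Longrightarrow> (d has_integral D b - D a) {a..b}"
  shows "continuous_on UNIV D"
proof -
  have "isCont D x" for x
  proof -
    have "continuous_on {x - 1..x + 1} (\<lambda>y. D (x - 1) + integral {x - 1..y} d)"
      by (intro continuous_intros indefinite_integral_continuous_1 has_integral_integrable[OF D]) simp
    moreover have "D (x - 1) + integral {x - 1..y} d = D y" if "y \<in> {x - 1..x + 1}" for y
      using D[of "x - 1" y] that by (simp add: integral_unique)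
    ultimately have "continuous_on {x - 1..x + 1} D"
      by (subst continuous_on_cong[OF refl, of _ D "\<lambda>y. D (x - 1) + integral {x - 1..y} d"]) auto
    then show ?thesis by (rule continuous_on_interior) simp
  qed
  then show ?thesis by (simp add: continuous_at_imp_continuous_on)
qed

lemma continuous_indefinite_integral:
  fixes F :: "real \<Rightarrow> complex"
  assumes "continuous_on UNIV F"
  obtains G where "\<And>a b. a \<le> b \<Longrightarrow> (F has_integral G b - G a) {a..b}"
proof
  \<comment> \<open>The oriented integral from 0: for each \<open>x\<close> at least one of the two
    intervals is empty or a single point.\<close>
  define G where "G x = integral {0..x} F - integral {x..0} F" for x
  have int: "F integrable_on {a..b}" for a b
    using assms continuous_on_subset by (intro integrable_continuous_real) blast
  fix a b :: real assume ab: "a \<le> b"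
  note comb = Henstock_Kurzweil_Integration.integral_combine[OF _ _ int]
  have "G b - G a = integral {a..b} F"
  proof -
    consider "0 \<le> a" | "a < 0" "0 \<le> b" | "b < 0" by linarith
    then show ?thesis
    proof cases
      case 1
      then show ?thesis using comb[of 0 a b] ab by (cases "a = 0"; cases "b = 0") (auto simp: G_def algebra_simps)
    next
      case 2
      then show ?thesis using comb[of a 0 b] ab by (cases "b = 0") (auto simp: G_def algebra_simps)
    next
      case 3
      then show ?thesis using comb[of a b 0] ab by (auto simp: G_def algebra_simps)
    qed
  qed
  then show "(F has_integral G b - G a) {a..b}"
    using int by (simp add: has_integral_integral)
qed

section \<open>Translation and reflection of periodic functions\<close>

text \<open>A primitive \<open>G\<close> has equal increments over an interval and over its
  translate by a period, so \<open>G (a + 2 * pi) - G a\<close> does not depend on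
  \<open>a\<close>.\<close>

lemma integral_periodic:
  fixes k :: "real \<Rightarrow> complex"
  assumes per: "periodic_2pi k" and cont: "continuous_on UNIV k"
  shows "integral {a..a + 2 * pi} k = integral {0..2 * pi} k"
proof -
  define H where "H a = integral {a..a + 2 * pi} k" for a
  obtain G where G: "\<And>a b. a \<le> b \<Longrightarrow> (k has_integral G b - G a) {a..b}"
    using continuous_indefinite_integral[OF cont] by blast
  have HG: "H a = G (a + 2 * pi) - G a" for a
    unfolding H_def by (intro integral_unique G) simp
  have ck: "continuous_on S k" for S
    using cont continuous_on_subset by blast
  have shift: "integral {a + 2 * pi..b + 2 * pi} k = integral {a..b} k" for a b
    using integral_shift[of a "2 * pi" b k] ck per by (simp add: o_def periodic_2pi_def)
  have "H b = H a" if "a \<le> b" for a b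
  proof -
    have "G (b + 2 * pi) - G (a + 2 * pi) = G b - G a"
      using integral_unique[OF G[of a b]] integral_unique[OF G[of "a + 2 * pi" "b + 2 * pi"]] shift[of a b] that
      by simp
    then show ?thesis unfolding HG by (simp add: algebra_simps)
  qed
  then have "H a = H 0" by (metis linear)
  then show ?thesis by (simp add: H_def)
qed

lemma has_integral_reflect_shift:
  fixes d :: "real \<Rightarrow> complex"
  assumes "(d has_integral I) {s - b..s - a}"
  shows "((\<lambda>x. d (s - x)) has_integral I) {a..b}"
proof -
  have "(\<lambda>x. s - x) ` {s - b..s - a} = {a..b}"
    by (auto simp: image_iff intro!: bexI[of _ "s - _"])
  then have "(\<lambda>x. - x + s) ` {s - b..s - a} = {a..b}" by simp
  then show ?thesis
    using has_integral_affinity[of d I "s - b" "s - a" "-1" s] assms by simp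
qed

lemma periodic_cis_int: "periodic_2pi (\<lambda>x. cis (of_int n * x))"
  unfolding periodic_2pi_def
proof
  fix x
  have "cis (of_int n * (2 * pi)) = 1"
    by (metis cis_multiple_2pi Ints_of_int mult.commute)
  then show "cis (of_int n * (x + 2 * pi)) = cis (of_int n * x)"
    by (simp add: distrib_left flip: cis_mult)
qed

text \<open>A sample \<open>f (t p - \<tau>)\<close> depends on \<open>\<tau>\<close> through a
  reflection; this is why coefficients at \<open>- n\<close> appear later.\<close>

lemma fc_reflect_shift:
  assumes per: "periodic_2pi g" and cont: "continuous_on UNIV g"
  shows "fc (\<lambda>x. g (s - x)) n = cis (- (of_int n * s)) * fc g (- n)"
proof -
  define k where "k x = g x * cis (of_int n * x)" for x
  have k: "periodic_2pi k" "continuous_on UNIV k"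
    using per periodic_cis_int[of n] cont unfolding k_def periodic_2pi_def
    by (auto intro!: continuous_intros)
  have kint: "k integrable_on S" if "S = {s - 2 * pi..s}" for S
    using k(2) continuous_on_subset unfolding that by (intro integrable_continuous_real) blast
  have "(k has_integral integral {0..2 * pi} k) {s - 2 * pi..s}"
    using integral_periodic[OF k, of "s - 2 * pi"] kint by (simp add: has_integral_integrable_integral)
  then have "((\<lambda>x. cis (- (of_int n * s)) * k (s - x)) has_integral cis (- (of_int n * s)) * integral {0..2 * pi} k) {0..2 * pi}"
    by (intro has_integral_mult_right has_integral_reflect_shift) simp
  moreover have "cis (- (of_int n * s)) * k (s - x) = g (s - x) * cis (- (of_int n * x))" for x
    by (simp add: k_def cis_mult right_diff_distrib mult.left_commute)
  ultimately have "((\<lambda>x. g (s - x) * cis (- (of_int n * x))) has_integral cis (- (of_int n * s)) * integral {0..2 * pi} k) {0..2 * pi}"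
    by (simp only:)
  then show ?thesis
    unfolding fc_def by (simp add: integral_unique k_def[abs_def])
qed

text \<open>A translation is the composition of two reflections.\<close>

lemma fc_shift:
  assumes per: "periodic_2pi g" and cont: "continuous_on UNIV g"
  shows "fc (\<lambda>x. g (x + h)) n = cis (of_int n * h) * fc g n"
proof -
  have "periodic_2pi (\<lambda>x. g (- x))"
    unfolding periodic_2pi_def
  proof
    fix x
    have "g (- (x + 2 * pi) + 2 * pi) = g (- (x + 2 * pi))"
      using per unfolding periodic_2pi_def by blast
    then show "g (- (x + 2 * pi)) = g (- x)" by simp
  qed
  moreover have "continuous_on UNIV (\<lambda>x. g (- x))"
    by (intro continuous_on_compose2[OF cont] continuous_intros) auto
  ultimately show ?thesis
    using fc_reflect_shift[of "\<lambda>x. g (- x)" "- h" n] fc_reflect_shift[OF assms, of 0 "- n"]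
    by (simp add: add.commute)
qed

text \<open>The link between formal and true coefficients. A primitive of \<open>d\<close> is
  periodic only after removal of the linear term given by the mean \<open>c\<close>; for
  \<open>d - c\<close> the boundary terms of the integration by parts cancel, and subtracting
  \<open>c\<close> changes no coefficient with \<open>n \<noteq> 0\<close>.\<close>

lemma fc_of_indefinite_integral:
  assumes d: "d absolutely_integrable_on {0..2 * pi}"
    and P: "periodic_2pi P" "continuous_on UNIV P"
    and int: "\<And>a b. a \<le> b \<Longrightarrow> (d has_integral P b - P a + c * of_real (b - a)) {a..b}"
  shows "fc d n = (if n = 0 then c else \<i> * of_int n * fc P n)"
proof -
  have P0: "P (2 * pi) = P 0"
    using P(1) by (metis add_0 periodic_2pi_def)
  show ?thesis
  proof (cases "n = 0")
    case True
    then show ?thesis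
      using integral_unique[OF int[of 0 "2 * pi"]] P0 by (simp add: fc_def)
  next
    case False
    define e where "e x = cis (of_int (- n) * x)" for x
    have c: "((\<lambda>x. c) has_integral c * of_real (b - a)) {a..b}" if "a \<le> b" for a b
      using has_integral_const_real[of c a b] that by (simp add: scaleR_conv_of_real mult.commute)
    have "integral {0..2 * pi} (\<lambda>x. (d x - c) * e x) =
      P (2 * pi) * e (2 * pi) - P 0 * e 0 - integral {0..2 * pi} (\<lambda>x. P x * (\<i> * of_real (of_int (- n)) * e x))"
      unfolding e_def
    proof (rule integral_by_parts_indefinite)
      show "(\<lambda>x. d x - c) absolutely_integrable_on {0..2 * pi}"
        by (intro set_integral_diff(1) d continuous_abs_integrable continuous_intros)
      show "((\<lambda>x. d x - c) has_integral P v - P u) {u..v}" if "u \<le> v" for u v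
        using has_integral_diff[OF int[OF that] c[OF that]] by simp
      show "((\<lambda>x. cis (of_int (- n) * x)) has_vector_derivative
          \<i> * of_real (of_int (- n)) * cis (of_int (- n) * x)) (at x)" for x
        by (rule has_vector_derivative_cis_mult)
      show "cmod (\<i> * of_real (of_int (- n)) * cis (of_int (- n) * x)) \<le> \<bar>of_int n\<bar>" for x
        by (simp add: norm_mult)
    qed (auto intro!: continuous_intros)
    moreover have "e (2 * pi) = e 0"
      using periodic_cis_int[of "- n"] unfolding e_def by (metis add_0 periodic_2pi_def)
    moreover have "integral {0..2 * pi} (\<lambda>x. (d x - c) * e x) = of_real (2 * pi) * fc d n"
    proof -
      have "((\<lambda>x. d x * e x - c * e x) has_integral of_real (2 * pi) * fc d n - c * 0) {0..2 * pi}"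
        using fc_has_integral[OF d, of n] integral_cis[of "- n"] False unfolding e_def
        by (intro has_integral_diff has_integral_mult_right) auto
      then show ?thesis by (simp add: left_diff_distrib integral_unique)
    qed
    moreover have "integral {0..2 * pi} (\<lambda>x. P x * (\<i> * of_real (of_int (- n)) * e x)) =
        - \<i> * of_int n * (of_real (2 * pi) * fc P n)"
    proof -
      have "((\<lambda>x. (- \<i> * of_int n) * (P x * e x)) has_integral - \<i> * of_int n * (of_real (2 * pi) * fc P n)) {0..2 * pi}"
        using fc_has_integral[OF continuous_abs_integrable, of P n] P(2) continuous_on_subset
        unfolding e_def by (intro has_integral_mult_right) auto
      moreover have "(- \<i> * of_int n) * (P x * e x) = P x * (\<i> * of_real (of_int (- n)) * e x)" for x
        by simp
      ultimately show ?thesis by (simp only: integral_unique)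
    qed
    ultimately show ?thesis using False P0 by simp
  qed
qed

text \<open>\<open>weak_fourier d c\<close>: \<open>c\<close> are the Fourier coefficients of the possibly only Henstock-Kurzweil
  integrable function \<open>d\<close>, read off from its indefinite integral, so that \<open>d x * cis (- n * x)\<close>
  never has to be integrated.\<close>

definition weak_fourier :: "(real \<Rightarrow> complex) \<Rightarrow> (int \<Rightarrow> complex) \<Rightarrow> bool" where
  "weak_fourier d c \<longleftrightarrow> (\<exists>P. periodic_2pi P \<and> continuous_on UNIV P \<and>
     (\<forall>a b. a \<le> b \<longrightarrow> (d has_integral P b - P a + c 0 * of_real (b - a)) {a..b}) \<and>
     (\<forall>n. n \<noteq> 0 \<longrightarrow> c n = \<i> * of_int n * fc P n))"

lemma weak_fourierE:
  assumes "weak_fourier d c"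
  obtains P where "periodic_2pi P" "continuous_on UNIV P"
    "\<And>a b. a \<le> b \<Longrightarrow> (d has_integral P b - P a + c 0 * of_real (b - a)) {a..b}"
    "\<And>n. n \<noteq> 0 \<Longrightarrow> c n = \<i> * of_int n * fc P n"
  using assms unfolding weak_fourier_def by blast

lemma weak_fourierI:
  assumes "periodic_2pi P" "continuous_on UNIV P"
    "\<And>a b. a \<le> b \<Longrightarrow> (d has_integral P b - P a + c 0 * of_real (b - a)) {a..b}"
    "\<And>n. n \<noteq> 0 \<Longrightarrow> c n = \<i> * of_int n * fc P n"
  shows "weak_fourier d c"
  using assms unfolding weak_fourier_def by blast

lemma continuous_UNIV_abs_integrable:
  fixes g :: "real \<Rightarrow> complex"
  assumes "continuous_on UNIV g"
  shows "g absolutely_integrable_on {a..b}"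
  using assms continuous_on_subset by (intro continuous_abs_integrable) blast

lemma weak_fourier_add:
  assumes "weak_fourier d c" "weak_fourier d' c'"
  shows "weak_fourier (\<lambda>x. d x + d' x) (\<lambda>n. c n + c' n)"
proof -
  obtain P where P: "periodic_2pi P" "continuous_on UNIV P"
    "\<And>a b. a \<le> b \<Longrightarrow> (d has_integral P b - P a + c 0 * of_real (b - a)) {a..b}"
    "\<And>n. n \<noteq> 0 \<Longrightarrow> c n = \<i> * of_int n * fc P n"
    using weak_fourierE[OF assms(1)] by metis
  obtain Q where Q: "periodic_2pi Q" "continuous_on UNIV Q"
    "\<And>a b. a \<le> b \<Longrightarrow> (d' has_integral Q b - Q a + c' 0 * of_real (b - a)) {a..b}"
    "\<And>n. n \<noteq> 0 \<Longrightarrow> c' n = \<i> * of_int n * fc Q n"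
    using weak_fourierE[OF assms(2)] by metis
  show ?thesis
  proof (rule weak_fourierI)
    show "periodic_2pi (\<lambda>x. P x + Q x)" using P(1) Q(1) by (simp add: periodic_2pi_def)
    show "continuous_on UNIV (\<lambda>x. P x + Q x)" by (intro continuous_intros P Q)
    show "((\<lambda>x. d x + d' x) has_integral P b + Q b - (P a + Q a) + (c 0 + c' 0) * of_real (b - a)) {a..b}"
      if "a \<le> b" for a b
      using has_integral_add[OF P(3)[OF that] Q(3)[OF that]] by (simp add: algebra_simps)
    show "c n + c' n = \<i> * of_int n * fc (\<lambda>x. P x + Q x) n" if "n \<noteq> 0" for n
      using that P(4) Q(4) by (subst fc_add) (auto intro!: continuous_UNIV_abs_integrable P Q simp: algebra_simps)
  qed
qed

lemma weak_fourier_cmult: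
  assumes "weak_fourier d c"
  shows "weak_fourier (\<lambda>x. r * d x) (\<lambda>n. r * c n)"
proof -
  obtain P where P: "periodic_2pi P" "continuous_on UNIV P"
    "\<And>a b. a \<le> b \<Longrightarrow> (d has_integral P b - P a + c 0 * of_real (b - a)) {a..b}"
    "\<And>n. n \<noteq> 0 \<Longrightarrow> c n = \<i> * of_int n * fc P n"
    using weak_fourierE[OF assms(1)] by metis
  show ?thesis
  proof (rule weak_fourierI)
    show "periodic_2pi (\<lambda>x. r * P x)" using P(1) by (simp add: periodic_2pi_def)
    show "continuous_on UNIV (\<lambda>x. r * P x)" by (intro continuous_intros P)
    show "((\<lambda>x. r * d x) has_integral r * P b - r * P a + r * c 0 * of_real (b - a)) {a..b}"
      if "a \<le> b" for a b
      using has_integral_mult_right[OF P(3)[OF that], of r] by (simp add: algebra_simps)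
    show "r * c n = \<i> * of_int n * fc (\<lambda>x. r * P x) n" if "n \<noteq> 0" for n
      using that P(4) by (simp add: fc_cmult)
  qed
qed

lemma weak_fourier_sum:
  assumes "finite A" "\<And>i. i \<in> A \<Longrightarrow> weak_fourier (d i) (c i)"
  shows "weak_fourier (\<lambda>x. \<Sum>i\<in>A. d i x) (\<lambda>n. \<Sum>i\<in>A. c i n)"
  using assms
proof (induction A rule: finite_induct)
  case empty
  show ?case
    by (rule weak_fourierI[of "\<lambda>_. 0"]) (auto simp: periodic_2pi_def fc_def)
next
  case (insert i A)
  then show ?case using weak_fourier_add[of "d i" "c i"] by simp
qed

lemma weak_fourier_reflect_shift:
  assumes "weak_fourier d c"
  shows "weak_fourier (\<lambda>x. d (s - x)) (\<lambda>n. cis (- (of_int n * s)) * c (- n))"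
proof -
  obtain P where P: "periodic_2pi P" "continuous_on UNIV P"
    "\<And>a b. a \<le> b \<Longrightarrow> (d has_integral P b - P a + c 0 * of_real (b - a)) {a..b}"
    "\<And>n. n \<noteq> 0 \<Longrightarrow> c n = \<i> * of_int n * fc P n"
    using weak_fourierE[OF assms(1)] by metis
  show ?thesis
  proof (rule weak_fourierI)
    \<comment> \<open>Reflection reverses orientation, hence the sign of the primitive; it is
      written as a factor so that \<open>fc_cmult\<close> applies.\<close>
    show "periodic_2pi (\<lambda>x. - 1 * P (s - x))"
      unfolding periodic_2pi_def
    proof
      fix x
      have "P (s - (x + 2 * pi) + 2 * pi) = P (s - (x + 2 * pi))"
        using P(1) unfolding periodic_2pi_def by blast
      then show "- 1 * P (s - (x + 2 * pi)) = - 1 * P (s - x)" by simp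
    qed
    show "continuous_on UNIV (\<lambda>x. - 1 * P (s - x))"
      by (intro continuous_intros continuous_on_compose2[OF P(2)]) auto
    show "((\<lambda>x. d (s - x)) has_integral - 1 * P (s - b) - - 1 * P (s - a) +
        cis (- (of_int 0 * s)) * c (- 0) * of_real (b - a)) {a..b}" if "a \<le> b" for a b
      using that P(3)[of "s - b" "s - a"] by (intro has_integral_reflect_shift) simp
    show "cis (- (of_int n * s)) * c (- n) = \<i> * of_int n * fc (\<lambda>x. - 1 * P (s - x)) n" if "n \<noteq> 0" for n
      unfolding fc_cmult using that P(4)[of "- n"] by (simp add: fc_reflect_shift[OF P(1,2)])
  qed
qed

lemma weak_fourier_continuous:
  assumes per: "periodic_2pi F" and cont: "continuous_on UNIV F"
  shows "weak_fourier F (fc F)"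
proof -
  obtain G where G: "\<And>a b. a \<le> b \<Longrightarrow> (F has_integral G b - G a) {a..b}"
    using continuous_indefinite_integral[OF cont] by blast
  \<comment> \<open>Subtracting the mean times \<open>x\<close> turns the primitive into a periodic
    function.\<close>
  define P where "P x = G x - fc F 0 * of_real x" for x
  have "continuous_on UNIV G"
    using G by (rule continuous_on_indefinite_integral_UNIV)
  then have cP: "continuous_on UNIV P" unfolding P_def by (intro continuous_intros)
  have pP: "periodic_2pi P"
    unfolding periodic_2pi_def
  proof
    fix x
    have "G (x + 2 * pi) - G x = integral {x..x + 2 * pi} F"
      using G[of x "x + 2 * pi"] by (simp add: integral_unique)
    also have "\<dots> = fc F 0 * of_real (2 * pi)"
      unfolding integral_periodic[OF assms] by (simp add: fc_def)
    finally show "P (x + 2 * pi) = P x" by (simp add: P_def algebra_simps)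
  qed
  have int: "(F has_integral P b - P a + fc F 0 * of_real (b - a)) {a..b}" if "a \<le> b" for a b
    using G[OF that] by (simp add: P_def algebra_simps)
  show ?thesis
  proof (rule weak_fourierI[of P])
    show "fc F n = \<i> * of_int n * fc P n" if "n \<noteq> 0" for n
      using fc_of_indefinite_integral[OF continuous_UNIV_abs_integrable[OF cont] pP cP int, of n] that by simp
  qed (use pP cP int in auto)
qed

subsection \<open>Parseval's identity for Henstock-Kurzweil integrable functions\<close>

lemma set_nn_integral_lebesgue_eq:
  fixes u :: "real \<Rightarrow> real"
  assumes "(u has_integral I) S" "\<And>x. 0 \<le> u x"
  shows "(\<integral>\<^sup>+ x\<in>S. ennreal (u x) \<partial>lebesgue) = ennreal I"
  using nn_integral_has_integral_lebesgue'[of S u I] assms by (simp add: nn_integral_completion)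

lemma cmod_cis_minus_one_le: "cmod (cis u - 1) \<le> \<bar>u\<bar>"
proof -
  have "cmod (cis u - 1) = 2 * \<bar>sin (u / 2)\<bar>"
    using dist_exp_i_1[of u] by (simp add: cis_conv_exp)
  also have "\<dots> \<le> 2 * \<bar>u / 2\<bar>"
    by (intro mult_left_mono abs_sin_x_le_abs_x) auto
  finally show ?thesis by simp
qed

lemma weak_fourier_measurable:
  assumes "weak_fourier d c" "a \<le> b"
  shows "(\<lambda>x. indicator {a..b} x *\<^sub>R d x) \<in> borel_measurable lebesgue"
proof -
  obtain I where "(d has_integral I) {a..b}"
    using weak_fourierE[OF assms(1)] assms(2) by metis
  then show ?thesis by (rule has_integral_implies_lebesgue_measurable)
qed

lemma weak_fourier_measurable_sq:
  assumes "weak_fourier d c" "a \<le> b"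
  shows "(\<lambda>x. ennreal ((cmod (d x))\<^sup>2) * indicator {a..b} x) \<in> borel_measurable lebesgue"
proof -
  have "(\<lambda>x. ennreal ((cmod (indicator {a..b} x *\<^sub>R d x))\<^sup>2)) \<in> borel_measurable lebesgue"
    using weak_fourier_measurable[OF assms] by measurable
  moreover have "ennreal ((cmod (indicator {a..b} x *\<^sub>R d x))\<^sup>2) = ennreal ((cmod (d x))\<^sup>2) * indicator {a..b} x" for x
    by (auto simp: indicator_def)
  ultimately show ?thesis by (simp only:)
qed

text \<open>Only a finite right-hand side matters. Then
  \<open>cmod (d x) \<le> 1 + (cmod (d x))\<^sup>2\<close> upgrades Henstock-Kurzweil integrability
  to absolute integrability, \<open>fc_of_indefinite_integral\<close> identifies \<open>c\<close>
  with the true coefficients, and the ordinary Bessel inequality applies.\<close>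

lemma weak_fourier_bessel:
  assumes wf: "weak_fourier d c"
  shows "ennreal (2 * pi) * (\<Sum>\<^sub>\<infinity>n. ennreal ((cmod (c n))\<^sup>2)) \<le> (\<integral>\<^sup>+ x\<in>{0..2 * pi}. ennreal ((cmod (d x))\<^sup>2) \<partial>lebesgue)"
    (is "_ \<le> ?X")
proof (cases "?X = \<infinity>")
  case True
  then show ?thesis by simp
next
  case False
  then obtain I where I: "?X = ennreal I" "0 \<le> I"
    by (cases ?X rule: ennreal_cases) auto
  let ?S = "{0..2 * pi}"
  let ?u = "\<lambda>x. indicator ?S x * (cmod (d x))\<^sup>2"
  obtain P where P: "periodic_2pi P" "continuous_on UNIV P"
    "\<And>a b. a \<le> b \<Longrightarrow> (d has_integral P b - P a + c 0 * of_real (b - a)) {a..b}"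
    "\<And>n. n \<noteq> 0 \<Longrightarrow> c n = \<i> * of_int n * fc P n"
    using weak_fourierE[OF wf] by metis
  have meas: "(\<lambda>x. indicator ?S x *\<^sub>R d x) \<in> borel_measurable lebesgue"
    using weak_fourier_measurable[OF wf] by simp
  have "(\<lambda>x. (cmod (indicator ?S x *\<^sub>R d x))\<^sup>2) \<in> borel_measurable lebesgue"
    using meas by measurable
  moreover have "(\<lambda>x. (cmod (indicator ?S x *\<^sub>R d x))\<^sup>2) = ?u"
    by (auto simp: indicator_def)
  ultimately have "?u \<in> borel_measurable lebesgue" by simp
  moreover have "integral\<^sup>N lebesgue ?u = ?X"
    by (intro nn_integral_cong) (auto simp: indicator_def)
  ultimately have "(?u has_integral I) UNIV"
    using I by (subst has_integral_iff_nn_integral_lebesgue) auto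
  moreover have "?u = (\<lambda>x. if x \<in> ?S then (cmod (d x))\<^sup>2 else 0)"
    by (auto simp: indicator_def)
  ultimately have sq: "((\<lambda>x. (cmod (d x))\<^sup>2) has_integral I) ?S"
    by (simp only: has_integral_restrict_UNIV)
  have d: "d absolutely_integrable_on ?S"
  proof (rule measurable_bounded_by_integrable_imp_absolutely_integrable)
    show "d \<in> borel_measurable (lebesgue_on ?S)"
      using meas by (subst borel_measurable_restrict_space_iff) auto
    show "(\<lambda>x. 1 + (cmod (d x))\<^sup>2) integrable_on ?S"
      using sq by (intro integrable_add) auto
    show "cmod (d x) \<le> 1 + (cmod (d x))\<^sup>2" for x
    proof -
      have "0 \<le> (cmod (d x) - 1 / 2)\<^sup>2" by simp
      then show ?thesis by (simp add: power2_eq_square algebra_simps)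
    qed
  qed auto
  have fc: "fc d n = c n" for n
    using fc_of_indefinite_integral[OF d P(1-3), of n] P(4)[of n] by auto
  have "(\<Sum>\<^sub>\<infinity>n. ennreal ((cmod (c n))\<^sup>2)) \<le> ennreal (I / (2 * pi))"
  proof -
    have "(\<Sum>n\<in>A. (cmod (c n))\<^sup>2) \<le> I / (2 * pi)" if "finite A" for A
      using bessel[OF d that sq] by (simp add: fc field_simps)
    then show ?thesis
      by (subst nonneg_infsum_complete) (auto simp: sum_ennreal intro!: SUP_least ennreal_leI)
  qed
  then have "ennreal (2 * pi) * (\<Sum>\<^sub>\<infinity>n. ennreal ((cmod (c n))\<^sup>2)) \<le> ennreal (2 * pi) * ennreal (I / (2 * pi))"
    by (rule mult_left_mono) simp
  also have "\<dots> = ?X"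
    using I by (simp add: ennreal_mult[symmetric])
  finally show ?thesis .
qed

text \<open>The means of \<open>d\<close> over \<open>[x, x + h]\<close> are continuous, have Fourier coefficients no larger than those of \<open>d\<close>,
  and converge to \<open>d\<close> almost everywhere; Fatou's lemma carries the bound over to \<open>d\<close>.\<close>

lemma weak_fourier_parseval_le:
  assumes wf: "weak_fourier d c"
  shows "(\<integral>\<^sup>+ x\<in>{0..2 * pi}. ennreal ((cmod (d x))\<^sup>2) \<partial>lebesgue) \<le> ennreal (2 * pi) * (\<Sum>\<^sub>\<infinity>n. ennreal ((cmod (c n))\<^sup>2))"
    (is "?X \<le> ?K")
proof -
  let ?S = "{0..2 * pi}"
  obtain P where P: "periodic_2pi P" "continuous_on UNIV P"
    "\<And>a b. a \<le> b \<Longrightarrow> (d has_integral P b - P a + c 0 * of_real (b - a)) {a..b}"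
    "\<And>n. n \<noteq> 0 \<Longrightarrow> c n = \<i> * of_int n * fc P n"
    using weak_fourierE[OF wf] by metis
  define h where "h m = 1 / real (Suc m)" for m
  have h0: "h m > 0" for m by (simp add: h_def)
  have h_lim: "h \<longlonglongrightarrow> 0"
    unfolding h_def using LIMSEQ_Suc[OF lim_const_over_n[of 1]] by simp
  \<comment> \<open>The mean of \<open>d\<close> over \<open>[x, x + h m]\<close>, expressed through
    \<open>P\<close>; this expression is continuous and periodic whatever the integrability of
    \<open>d\<close>.\<close>
  define D where "D m x = of_real (1 / h m) * (P (x + h m) + (- 1) * P x) + c 0" for m x
  have contP: "continuous_on UNIV (\<lambda>x. P (x + r))" for r
    by (intro continuous_on_compose2[OF P(2)] continuous_intros) auto
  have contD: "continuous_on UNIV (D m)" for m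
    unfolding D_def by (intro continuous_intros contP P(2))
  have perP: "periodic_2pi (\<lambda>x. P (x + r))" for r
    unfolding periodic_2pi_def
  proof
    fix x
    have "P (x + r + 2 * pi) = P (x + r)" using P(1) unfolding periodic_2pi_def by blast
    then show "P (x + 2 * pi + r) = P (x + r)" by (simp add: add_ac)
  qed
  have perD: "periodic_2pi (D m)" for m
    using perP[of "h m"] P(1) unfolding D_def periodic_2pi_def by simp
  \<comment> \<open>For \<open>n \<noteq> 0\<close>, averaging multiplies \<open>c n\<close> by
    \<open>(cis (n * h) - 1) / (\<i> * n * h)\<close>, of modulus at most 1 because a chord is no
    longer than its arc. The mean \<open>c 0\<close> is preserved.\<close>
  have fcD: "cmod (fc (D m) n) \<le> cmod (c n)" for m n
  proof -
    have "fc (D m) n = fc (\<lambda>x. of_real (1 / h m) * (P (x + h m) + (- 1) * P x)) n + fc (\<lambda>x. c 0) n"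
      unfolding D_def by (intro fc_add continuous_UNIV_abs_integrable continuous_intros contP P(2))
    also have "fc (\<lambda>x. of_real (1 / h m) * (P (x + h m) + (- 1) * P x)) n =
        of_real (1 / h m) * (fc (\<lambda>x. P (x + h m)) n + (- 1) * fc P n)"
    proof -
      have "fc (\<lambda>x. P (x + h m) + (- 1) * P x) n = fc (\<lambda>x. P (x + h m)) n + fc (\<lambda>x. (- 1) * P x) n"
        by (intro fc_add continuous_UNIV_abs_integrable continuous_intros contP P(2))
      then show ?thesis by (simp only: fc_cmult)
    qed
    also have "\<dots> = of_real (1 / h m) * ((cis (of_int n * h m) - 1) * fc P n)"
      unfolding fc_shift[OF P(1,2)] by (simp add: algebra_simps)
    also have "fc (\<lambda>x. c 0) n = (if n = 0 then c 0 else 0)"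
    proof -
      have "fc (\<lambda>x. c 0 * cis (of_int 0 * x)) n = c 0 * (if 0 = n then 1 else 0)"
        by (simp only: fc_cmult fc_cis)
      then show ?thesis by (cases "n = 0") simp_all
    qed
    finally have eq: "fc (D m) n = of_real (1 / h m) * ((cis (of_int n * h m) - 1) * fc P n) + (if n = 0 then c 0 else 0)" .
    show ?thesis
    proof (cases "n = 0")
      case False
      have "cmod (fc (D m) n) = (1 / h m) * cmod (cis (of_int n * h m) - 1) * cmod (fc P n)"
        using h0[of m] False by (simp add: eq norm_mult norm_divide)
      also have "\<dots> \<le> (1 / h m) * \<bar>of_int n * h m\<bar> * cmod (fc P n)"
        using h0[of m] by (intro mult_right_mono mult_left_mono cmod_cis_minus_one_le) auto
      also have "\<dots> = cmod (c n)"
        using h0[of m] P(4)[OF False] by (simp add: norm_mult abs_mult)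
      finally show ?thesis .
    next
      case True
      then have "fc (D m) n = c n" by (simp add: eq[unfolded True])
      then show ?thesis by simp
    qed
  qed
  have bound: "(\<integral>\<^sup>+ x\<in>?S. ennreal ((cmod (D m x))\<^sup>2) \<partial>lebesgue) \<le> ?K" for m
  proof -
    let ?J = "integral ?S (\<lambda>x. (cmod (D m x))\<^sup>2)"
    have "((\<lambda>x. (cmod (D m x))\<^sup>2) has_integral ?J) ?S"
      using contD[of m] continuous_on_subset
      by (intro integrable_integral integrable_continuous_real continuous_intros) blast
    then have "(\<integral>\<^sup>+ x\<in>?S. ennreal ((cmod (D m x))\<^sup>2) \<partial>lebesgue) = ennreal ?J"
      by (rule set_nn_integral_lebesgue_eq) simp
    also have "\<dots> = ennreal (2 * pi) * ennreal (?J / (2 * pi))"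
      by (simp add: ennreal_mult'[symmetric])
    also have "\<dots> = ennreal (2 * pi) * (\<Sum>\<^sub>\<infinity>n. ennreal ((cmod (fc (D m) n))\<^sup>2))"
      by (simp add: parseval_continuous[OF perD contD])
    also have "\<dots> \<le> ?K"
      by (intro mult_left_mono infsum_mono nonneg_summable_on_complete ennreal_leI power_mono fcD) auto
    finally show ?thesis .
  qed
  \<comment> \<open>Almost everywhere differentiation of the indefinite integral, which asks only
    for gauge integrability on each interval.\<close>
  obtain N where N: "negligible N" and lim: "\<And>x e. \<lbrakk>x \<notin> N; 0 < e\<rbrakk> \<Longrightarrow>
      \<exists>\<delta>>0. \<forall>h. 0 < h \<and> h < \<delta> \<longrightarrow> norm (integral (cbox x (x + h *\<^sub>R One)) d /\<^sub>R h ^ DIM(real) - d x) < e"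
  proof (rule integrable_ccontinuous_explicit[of d])
    show "d integrable_on cbox a b" for a b
      using P(3)[of a b] by (cases "a \<le> b") (auto simp: has_integral_integrable)
  qed blast
  have conv: "(\<lambda>m. D m x) \<longlonglongrightarrow> d x" if x: "x \<notin> N" for x
  proof (rule tendstoI)
    fix e :: real assume "e > 0"
    with lim x obtain \<delta> where \<delta>: "\<delta> > 0"
      "\<And>h. 0 < h \<Longrightarrow> h < \<delta> \<Longrightarrow> norm (integral (cbox x (x + h *\<^sub>R One)) d /\<^sub>R h ^ DIM(real) - d x) < e"
      by metis
    have "\<forall>\<^sub>F m in sequentially. h m < \<delta>"
      using order_tendstoD(2)[OF h_lim \<delta>(1)] .
    then show "\<forall>\<^sub>F m in sequentially. dist (D m x) (d x) < e"
    proof eventually_elim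
      case (elim m)
      have "integral (cbox x (x + h m *\<^sub>R One)) d = P (x + h m) - P x + c 0 * of_real (h m)"
        using integral_unique[OF P(3)[of x "x + h m"]] h0[of m] by simp
      then have "integral (cbox x (x + h m *\<^sub>R One)) d /\<^sub>R h m ^ DIM(real) = D m x"
        using h0[of m] by (simp add: D_def scaleR_conv_of_real field_simps)
      then show ?case using \<delta>(2)[OF h0 elim] by (simp add: dist_norm)
    qed
  qed
  let ?u = "\<lambda>m x. ennreal ((cmod (D m x))\<^sup>2) * indicator ?S x"
  have "?X = (\<integral>\<^sup>+ x. liminf (\<lambda>m. ?u m x) \<partial>lebesgue)"
  proof (rule nn_integral_cong_AE)
    have "N \<in> null_sets lebesgue" using N by (simp add: negligible_iff_null_sets)
    then have "AE x in lebesgue. x \<notin> N" by (rule AE_not_in)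
    then show "AE x in lebesgue. ennreal ((cmod (d x))\<^sup>2) * indicator ?S x = liminf (\<lambda>m. ?u m x)"
    proof eventually_elim
      case (elim x)
      have "(\<lambda>m. ?u m x) \<longlonglongrightarrow> ennreal ((cmod (d x))\<^sup>2) * indicator ?S x"
        using conv[OF elim] by (cases "x \<in> ?S") (auto intro!: tendsto_ennrealI tendsto_intros)
      then show ?case by (simp add: lim_imp_Liminf)
    qed
  qed
  also have "\<dots> \<le> liminf (\<lambda>m. \<integral>\<^sup>+ x. ?u m x \<partial>lebesgue)"
    using weak_fourier_measurable_sq[OF weak_fourier_continuous[OF perD contD]]
    by (intro nn_integral_liminf) simp
  also have "\<dots> \<le> limsup (\<lambda>m. \<integral>\<^sup>+ x. ?u m x \<partial>lebesgue)"
    by (rule Liminf_le_Limsup) simp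
  also have "\<dots> \<le> ?K"
    by (intro Limsup_bounded always_eventually allI bound)
  finally show ?thesis .
qed

theorem weak_fourier_parseval:
  assumes "weak_fourier d c"
  shows "ennreal (1 / (2 * pi)) * (\<integral>\<^sup>+ x\<in>{0..2 * pi}. ennreal ((cmod (d x))\<^sup>2) \<partial>lebesgue) = (\<Sum>\<^sub>\<infinity>n. ennreal ((cmod (c n))\<^sup>2))"
proof -
  have "(\<integral>\<^sup>+ x\<in>{0..2 * pi}. ennreal ((cmod (d x))\<^sup>2) \<partial>lebesgue) = ennreal (2 * pi) * (\<Sum>\<^sub>\<infinity>n. ennreal ((cmod (c n))\<^sup>2))"
    by (intro antisym weak_fourier_bessel weak_fourier_parseval_le assms)
  moreover have "ennreal (1 / (2 * pi)) * ennreal (2 * pi) = 1"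
    by (simp add: ennreal_mult[symmetric])
  ultimately show ?thesis by (simp add: mult.assoc[symmetric])
qed

subsection \<open>The confluent Vandermonde matrix\<close>

lemma order_ge_2:
  fixes p :: "'a::field_char_0 poly"
  assumes "p \<noteq> 0" "poly p z = 0" "poly (pderiv p) z = 0"
  shows "order z p \<ge> 2"
proof -
  have "pderiv p \<noteq> 0"
  proof
    assume "pderiv p = 0"
    then obtain a where "p = [:a:]" using pderiv_iszero by blast
    with assms show False by simp
  qed
  then have "order z (pderiv p) \<noteq> 0" using assms(3) by (simp add: order_root)
  then show ?thesis using order_pderiv[OF assms(1,2)] by simp
qed

text \<open>Counting roots with multiplicity: each point of \<open>Z\<close> contributes at least 2
  to the sum of orders, which the degree bounds.\<close>

lemma double_roots_imp_zero:
  fixes p :: "'a::field_char_0 poly"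
  assumes Z: "finite Z" and deg: "degree p < 2 * card Z"
    and roots: "\<And>z. z \<in> Z \<Longrightarrow> poly p z = 0 \<and> poly (pderiv p) z = 0"
  shows "p = 0"
proof (rule ccontr)
  assume p: "p \<noteq> 0"
  have "2 * card Z = (\<Sum>z\<in>Z. 2)" by simp
  also have "\<dots> \<le> (\<Sum>z\<in>Z. order z p)"
    using order_ge_2[OF p] roots by (intro sum_mono) blast
  also have "\<dots> \<le> (\<Sum>z | poly p z = 0. order z p)"
    using roots by (intro sum_mono2 poly_roots_finite p) auto
  also have "\<dots> \<le> degree p" by (rule sum_order_le_degree[OF p])
  finally show False using deg by simp
qed

lemma cis_eq_imp_eq:
  assumes "cis x = cis y" "0 \<le> x" "x < 2 * pi" "0 \<le> y" "y < 2 * pi"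
  shows "x = y"
proof -
  have "Arg2pi (cis x) = x" if "0 \<le> x" "x < 2 * pi" for x
    using that by (intro Arg2pi_unique[of 1]) (auto simp: cis_conv_exp)
  with assms show ?thesis by metis
qed

lemma cis_add_nat: "cis (of_int (N + int k) * x) = cis (of_int N * x) * cis x ^ k"
  using cis_mult[of "of_int N * x" "of_nat k * x"] Complex.DeMoivre[of x k] by (simp add: distrib_right)

lemma pderiv_sum: "pderiv (\<Sum>i\<in>A. f i) = (\<Sum>i\<in>A. pderiv (f i))"
  for f :: "'b \<Rightarrow> 'a::idom poly"
  by (induction A rule: infinite_finite_induct) (auto simp: pderiv_add)

text \<open>The rows of the matrix belong to frequencies and the columns to samples, so a kernel
  vector of the transpose is the coefficient vector of a polynomial \<open>p\<close> of degree below
  \<open>2 * m0\<close>. The columns force \<open>p\<close> to have a double root at each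
  \<open>cis (t q)\<close>, and these \<open>m0\<close> nodes are distinct.\<close>

lemma H_mat_invertible:
  assumes range: "\<forall>p\<in>{1..m0}. 0 \<le> t p \<and> t p < 2 * pi" and mono: "strict_mono_on {1..m0} t"
  shows "det (H_mat N1 m0 t) \<noteq> 0"
proof
  define n where "n = 2 * m0"
  define A where "A = transpose_mat (H_mat N1 m0 t)"
  have H: "H_mat N1 m0 t \<in> carrier_mat n n" by (simp add: H_mat_def n_def)
  then have A: "A \<in> carrier_mat n n" by (simp add: A_def)
  assume "det (H_mat N1 m0 t) = 0"
  then have "det A = 0" using det_transpose[OF H] by (simp add: A_def)
  then obtain v where v: "v \<in> carrier_vec n" "v \<noteq> 0\<^sub>v n" "A *\<^sub>v v = 0\<^sub>v n"
    using det_0_iff_vec_prod_zero[OF A] by blast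
  have ker: "(\<Sum>k<n. v_entry N1 t (k + 1) (j + 1) * vec_index v k) = 0" if "j < n" for j
  proof -
    have "vec_index (A *\<^sub>v v) j = 0" using that v(3) by simp
    moreover have "vec_index (A *\<^sub>v v) j = (\<Sum>k<n. v_entry N1 t (k + 1) (j + 1) * vec_index v k)"
      using that v(1) by (simp add: A_def H_mat_def n_def scalar_prod_def atLeast0LessThan)
    ultimately show ?thesis by simp
  qed
  define p where "p = (\<Sum>k<n. Polynomial.monom (vec_index v k) k)"
  have polyp: "poly p z = (\<Sum>k<n. vec_index v k * z ^ k)" for z
    by (simp add: p_def poly_sum poly_monom)
  \<comment> \<open>The factor \<open>z\<close> restores the exponent \<open>k\<close>:
    differentiating \<open>p (cis x)\<close> in \<open>x\<close> gives
    \<open>\<i> * z * p' z\<close> with \<open>z = cis x\<close>.\<close>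
  have polyp': "z * poly (pderiv p) z = (\<Sum>k<n. of_nat k * vec_index v k * z ^ k)" for z
  proof -
    have "z * poly (pderiv p) z = (\<Sum>k<n. z * (of_nat k * vec_index v k * z ^ (k - 1)))"
      by (simp add: p_def pderiv_sum pderiv_monom poly_sum poly_monom sum_distrib_left)
    also have "\<dots> = (\<Sum>k<n. of_nat k * vec_index v k * z ^ k)"
    proof (rule sum.cong[OF refl])
      show "z * (of_nat k * vec_index v k * z ^ (k - 1)) = of_nat k * vec_index v k * z ^ k" for k
        by (cases k) (auto simp: mult_ac)
    qed
    finally show ?thesis .
  qed
  define Z where "Z = (\<lambda>q. cis (t q)) ` {1..m0}"
  have "inj_on (\<lambda>q. cis (t q)) {1..m0}"
  proof (rule inj_onI)
    fix q r assume qr: "q \<in> {1..m0}" "r \<in> {1..m0}" "cis (t q) = cis (t r)"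
    then have "t q = t r" using range by (intro cis_eq_imp_eq) auto
    then show "q = r" using strict_mono_on_imp_inj_on[OF mono] qr by (auto dest: inj_onD)
  qed
  then have cardZ: "card Z = m0" by (simp add: Z_def card_image)
  \<comment> \<open>A nonzero vector needs positive dimension. Without this, the truncated
    \<open>n - 1\<close> in the degree bound would not be smaller than \<open>n\<close>.\<close>
  have n0: "n > 0"
    using v(1,2) by (metis carrier_vecD eq_vecI gr0I index_zero_vec(2) not_less0)
  have "p = 0"
  proof (rule double_roots_imp_zero)
    show "finite Z" by (simp add: Z_def)
    have "degree p \<le> n - 1"
      unfolding p_def by (intro degree_sum_le) (auto intro: order_trans[OF degree_monom_le])
    then show "degree p < 2 * card Z" using n0 by (simp add: cardZ n_def)
    fix z assume "z \<in> Z"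
    then obtain q where q: "q \<in> {1..m0}" "z = cis (t q)" by (auto simp: Z_def)
    from q(1) have q': "2 * q - 2 < n" "2 * q - 1 < n" unfolding n_def atLeastAtMost_iff by linarith+
    let ?c = "cis (of_int N1 * t q)"
    have "0 = (\<Sum>k<n. v_entry N1 t (k + 1) (2 * q - 2 + 1) * vec_index v k)"
      using ker[OF q'(1)] by simp
    also have "\<dots> = (\<Sum>k<n. ?c * (vec_index v k * z ^ k))"
    proof (rule sum.cong[OF refl])
      have q2: "2 * q - 2 + 1 = 2 * q - 1" "odd (2 * q - 1)" "(2 * q - 1 + 1) div 2 = q" using q by auto
      show "v_entry N1 t (k + 1) (2 * q - 2 + 1) * vec_index v k = ?c * (vec_index v k * z ^ k)" for k
        unfolding q2(1) v_entry_def Let_def q2(3) using q2(2) cis_add_nat[of N1 k "t q"]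
        by (simp add: q(2) mult_ac)
    qed
    also have "\<dots> = ?c * poly p z" by (simp add: polyp sum_distrib_left)
    finally have z0: "poly p z = 0" by (simp add: cis_neq_zero)
    have "0 = (\<Sum>k<n. v_entry N1 t (k + 1) (2 * q - 1 + 1) * vec_index v k)"
      using ker[OF q'(2)] by simp
    also have "\<dots> = (\<Sum>k<n. \<i> * ?c * (of_int N1 * (vec_index v k * z ^ k) + of_nat k * vec_index v k * z ^ k))"
    proof (rule sum.cong[OF refl])
      have q2: "2 * q - 1 + 1 = 2 * q" "even (2 * q)" "(2 * q + 1) div 2 = q" using q by auto
      show "v_entry N1 t (k + 1) (2 * q - 1 + 1) * vec_index v k =
          \<i> * ?c * (of_int N1 * (vec_index v k * z ^ k) + of_nat k * vec_index v k * z ^ k)" for k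
        unfolding q2(1) v_entry_def Let_def q2(3) using q2(2) cis_add_nat[of N1 k "t q"]
        by (simp add: q(2) algebra_simps)
    qed
    \<comment> \<open>This is the derivative of \<open>cis (N1 * x) * p (cis x)\<close> at
      \<open>t q\<close>; the first summand vanishes by \<open>z0\<close>.\<close>
    also have "\<dots> = \<i> * ?c * (of_int N1 * poly p z + z * poly (pderiv p) z)"
      by (simp only: polyp polyp' sum_distrib_left sum.distrib[symmetric] distrib_left)
    finally have "z * poly (pderiv p) z = 0" by (simp add: z0 cis_neq_zero)
    moreover have "z \<noteq> 0" by (simp add: q(2) cis_neq_zero)
    ultimately show "poly p z = 0 \<and> poly (pderiv p) z = 0" using z0 by simp
  qed
  have "vec_index v k = 0" if "k < n" for k
  proof -
    have "coeff p k = vec_index v k"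
      using that by (simp add: p_def coeff_sum coeff_monom if_distrib sum.delta cong: if_cong)
    then show ?thesis using \<open>p = 0\<close> by simp
  qed
  then have "v = 0\<^sub>v n" using v(1) by (intro eq_vecI) auto
  with v(2) show False by simp
qed

text \<open>With indices from 0, the columns \<open>2 * p - 2\<close> and \<open>2 * p - 1\<close>
  hold the value and the derivative sampled at \<open>t p\<close>.\<close>

lemma sum_pairs: "(\<Sum>j<2 * m. f j) = (\<Sum>p=1..m. f (2 * p - 2) + f (2 * p - 1))" for f :: "nat \<Rightarrow> 'a::comm_monoid_add"
  by (induction m) (auto simp: add.assoc)

text \<open>\<open>resp N1 m0 t k n\<close> is the coefficient at frequency \<open>N1 + k - 1\<close> of the operator applied to
  \<open>\<lambda>x. cis (n * x)\<close>.\<close>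

definition resp :: "int \<Rightarrow> nat \<Rightarrow> (nat \<Rightarrow> real) \<Rightarrow> nat \<Rightarrow> int \<Rightarrow> complex" where
  "resp N1 m0 t k n = (\<Sum>p=1..m0. cis (of_int n * t p) * w N1 m0 t (2 * p - 1) k +
     \<i> * of_int n * cis (of_int n * t p) * w N1 m0 t (2 * p) k)"

text \<open>Row \<open>l\<close> of the matrix lists the samples of the exponential of frequency
  \<open>N1 + l - 1\<close>, so the response is an entry of the matrix times its inverse.\<close>

lemma resp_eq_delta:
  assumes range: "\<forall>p\<in>{1..m0}. 0 \<le> t p \<and> t p < 2 * pi" and mono: "strict_mono_on {1..m0} t"
    and k: "k \<in> {1..2 * m0}" "l \<in> {1..2 * m0}"
  shows "resp N1 m0 t k (N1 + int l - 1) = (if l = k then 1 else 0)"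
proof -
  define H where "H = H_mat N1 m0 t"
  have H: "H \<in> carrier_mat (2 * m0) (2 * m0)" by (simp add: H_def H_mat_def)
  \<comment> \<open>The nonzero determinant rules out \<open>None\<close>, so \<open>the\<close> in
    the definition of \<open>w\<close> yields a genuine inverse.\<close>
  have "H \<in> Units (ring_mat TYPE(complex) (2 * m0) ())"
    using H_mat_invertible[OF range mono] H unfolding H_def by (intro det_non_zero_imp_unit) auto
  then obtain W where W: "mat_inverse H = Some W"
    using mat_inverse(1)[OF H, where b = "()"] by (cases "mat_inverse H") auto
  then have HW: "H * W = 1\<^sub>m (2 * m0)" and Wc: "W \<in> carrier_mat (2 * m0) (2 * m0)"
    using mat_inverse(2)[OF H W] by auto
  have w: "w N1 m0 t j k = W $$ (j - 1, k - 1)" for j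
    by (simp add: w_def W[unfolded H_def])
  have "(if l = k then 1 else 0) = (H * W) $$ (l - 1, k - 1)"
    using k HW by auto
  also have "\<dots> = (\<Sum>j<2 * m0. v_entry N1 t l (j + 1) * W $$ (j, k - 1))"
  proof -
    have "l - 1 < 2 * m0" "k - 1 < 2 * m0" "l - 1 + 1 = l" using k by auto
    then show ?thesis
      using Wc by (auto simp: H_def H_mat_def scalar_prod_def atLeast0LessThan)
  qed
  also have "\<dots> = (\<Sum>p=1..m0. v_entry N1 t l (2 * p - 2 + 1) * W $$ (2 * p - 2, k - 1) + v_entry N1 t l (2 * p - 1 + 1) * W $$ (2 * p - 1, k - 1))"
    by (rule sum_pairs)
  also have "\<dots> = resp N1 m0 t k (N1 + int l - 1)"
    unfolding resp_def
  proof (rule sum.cong[OF refl])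
    fix p assume p: "p \<in> {1..m0}"
    then have 1: "2 * p - 2 + 1 = 2 * p - 1" "odd (2 * p - 1)" "(2 * p - 1 + 1) div 2 = p" "2 * p - 1 - 1 = 2 * p - 2"
      and 2: "2 * p - 1 + 1 = 2 * p" "even (2 * p)" "(2 * p + 1) div 2 = p" by auto
    show "v_entry N1 t l (2 * p - 2 + 1) * W $$ (2 * p - 2, k - 1) + v_entry N1 t l (2 * p - 1 + 1) * W $$ (2 * p - 1, k - 1) =
      cis (of_int (N1 + int l - 1) * t p) * w N1 m0 t (2 * p - 1) k +
      \<i> * of_int (N1 + int l - 1) * cis (of_int (N1 + int l - 1) * t p) * w N1 m0 t (2 * p) k"
      unfolding w v_entry_def Let_def 1(1) 1(3) 2(1) 2(3) using 1(2,4) 2(2) by simp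
  qed
  finally show ?thesis by simp
qed

subsection \<open>The averaged error\<close>

lemma AE_reflect_shift:
  assumes "AE x in lebesgue. Q (x :: real)"
  shows "AE x in lebesgue. Q (s - x)"
proof -
  obtain N where N: "N \<in> null_sets lebesgue" "{x. \<not> Q x} \<subseteq> N"
    using assms by (auto simp: eventually_ae_filter)
  have "negligible ((\<lambda>x. s - x) ` N)"
    using N(1) by (intro negligible_differentiable_image_negligible)
      (auto simp: negligible_iff_null_sets intro!: derivative_intros)
  moreover have "{x. \<not> Q (s - x)} \<subseteq> (\<lambda>x. s - x) ` N"
  proof
    fix x assume "x \<in> {x. \<not> Q (s - x)}"
    then have "s - x \<in> N" using N(2) by auto
    then have "s - (s - x) \<in> (\<lambda>x. s - x) ` N" by (rule imageI)
    then show "x \<in> (\<lambda>x. s - x) ` N" by simp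
  qed
  ultimately show ?thesis
    by (intro AE_I'[of "(\<lambda>x. s - x) ` N"]) (auto simp: negligible_iff_null_sets)
qed

lemma AE_shift:
  assumes "AE x in lebesgue. Q (x :: real)"
  shows "AE x in lebesgue. Q (x + s)"
  using AE_reflect_shift[OF AE_reflect_shift[OF assms, of s], of 0] by (simp add: add.commute)

lemma AE_lebesgue_ex:
  assumes "AE x in lebesgue. Q (x :: real)"
  shows "\<exists>x. Q x"
proof (rule ccontr)
  assume "\<nexists>x. Q x"
  moreover obtain N where "N \<in> null_sets lebesgue" "{x. \<not> Q x} \<subseteq> N"
    using assms by (auto simp: eventually_ae_filter)
  ultimately have "negligible (UNIV :: real set)"
    by (metis (mono_tags, lifting) negligible_iff_null_sets Collect_cong UNIV_def negligible_subset)
  then show False by simp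
qed

lemma ennreal_sqrt_power2: "(ennreal_sqrt x)\<^sup>2 = x"
proof (cases x rule: ennreal_cases)
  case (real r)
  then show ?thesis by (simp add: ennreal_sqrt_def ennreal_power)
next
  case top
  then show ?thesis by (simp add: ennreal_sqrt_def ennreal_top_mult power2_eq_square)
qed

lemma ennreal_infsum_sum:
  fixes g :: "'a \<Rightarrow> 'b \<Rightarrow> ennreal"
  assumes "finite K"
  shows "(\<Sum>k\<in>K. \<Sum>\<^sub>\<infinity>n\<in>A. g k n) = (\<Sum>\<^sub>\<infinity>n\<in>A. \<Sum>k\<in>K. g k n)"
  using assms by induction (auto simp: infsum_add nonneg_summable_on_complete)

lemma ennreal_infsum_split:
  fixes g :: "'a \<Rightarrow> ennreal"
  assumes "finite I"
  shows "(\<Sum>\<^sub>\<infinity>n. g n) = (\<Sum>\<^sub>\<infinity>n\<in>- I. g n) + (\<Sum>n\<in>I. g n)"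
proof -
  have "infsum g (- I \<union> I) = infsum g (- I) + infsum g I"
    by (rule infsum_Un_disjoint) (auto intro: nonneg_summable_on_complete)
  then show ?thesis using assms by (simp add: Compl_partition2)
qed

lemma circle_derivativeE:
  assumes "circle_derivative f f'" "periodic_2pi f"
  obtains F where "continuous_on UNIV F" "periodic_2pi F" "AE x in lebesgue. f x = F x"
    "\<And>a b. a \<le> b \<Longrightarrow> (f' has_integral F b - F a) {a..b}"
proof -
  obtain F where F: "\<And>a b. a \<le> b \<Longrightarrow> (f' has_integral F b - F a) {a..b}" "AE x in lebesgue. f x = F x"
    and per: "periodic_2pi f'"
    using assms(1) unfolding circle_derivative_def by blast
  have inc: "F (b + 2 * pi) - F (a + 2 * pi) = F b - F a" if "a \<le> b" for a b
  proof -
    have "(\<lambda>x. x - 2 * pi) ` {a + 2 * pi..b + 2 * pi} = {a..b}"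
      by (auto simp: image_iff intro!: bexI[of _ "_ + 2 * pi"])
    then have "((\<lambda>x. f' (x + 2 * pi)) has_integral F (b + 2 * pi) - F (a + 2 * pi)) {a..b}"
      using has_integral_affinity[of f' "F (b + 2 * pi) - F (a + 2 * pi)" "a + 2 * pi" "b + 2 * pi" 1 "2 * pi"]
        F(1)[of "a + 2 * pi" "b + 2 * pi"] that by simp
    moreover have "(\<lambda>x. f' (x + 2 * pi)) = f'" using per by (simp add: periodic_2pi_def)
    ultimately show ?thesis using F(1)[OF that] by (auto intro: has_integral_unique)
  qed
  have "AE x in lebesgue. F (x + 2 * pi) = F x"
    using F(2) AE_shift[OF F(2), of "2 * pi"]
  proof eventually_elim
    case (elim x)
    then show ?case using assms(2) unfolding periodic_2pi_def by metis
  qed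
  then obtain y where y: "F (y + 2 * pi) = F y" using AE_lebesgue_ex by blast
  have "F (x + 2 * pi) = F x" for x
    using inc[of x y] inc[of y x] y by (cases "x \<le> y") auto
  then have "periodic_2pi F" by (simp add: periodic_2pi_def)
  with F continuous_on_indefinite_integral_UNIV[OF F(1)] that show ?thesis by blast
qed

lemma fourier_coeff_eq_fc:
  assumes f: "f \<in> borel_measurable lebesgue" and F: "continuous_on UNIV F" and eq: "AE x in lebesgue. f x = F x"
  shows "fourier_coeff f n = fc F n"
proof -
  let ?e = "\<lambda>x. cis (- (of_int n * x))"
  have e: "?e \<in> borel_measurable lebesgue" and F': "F \<in> borel_measurable lebesgue"
    using F by (auto intro!: borel_measurable_continuous_onI measurable_completion continuous_intros)
  have "(LINT x:{0..2 * pi}|lebesgue. f x * ?e x) = (LINT x:{0..2 * pi}|lebesgue. F x * ?e x)"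
    unfolding set_lebesgue_integral_def
    using f e F' eq
    by (intro integral_cong_AE borel_measurable_scaleR borel_measurable_times borel_measurable_indicator)
      (auto elim!: eventually_mono)
  also have "\<dots> = integral {0..2 * pi} (\<lambda>x. F x * ?e x)"
    by (intro set_lebesgue_integral_eq_integral(2) abs_integrable_mult_continuous
        continuous_UNIV_abs_integrable F continuous_intros)
  finally show ?thesis by (simp add: fourier_coeff_def fc_def)
qed

section \<open>The error for a fixed translate and its expansion in \<open>\<tau>\<close>\<close>

lemma I_set_bij: "bij_betw (\<lambda>k. N1 + int k - 1) {1..2 * m0} (I_set N1 m0)"
proof (rule bij_betwI[where g = "\<lambda>n. nat (n - N1 + 1)"])
qed (auto simp: I_set_def)

text \<open>The \<open>c\<^sub>k(\<tau>)\<close> of the overview. The sampled function is a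
  parameter so that \<open>f\<close> can be exchanged for \<open>F\<close> after the norm has been
  expanded.\<close>

definition sample_coeff where
  "sample_coeff N1 m0 t g g' k \<tau> =
     (\<Sum>p=1..m0. w N1 m0 t (2 * p - 1) k * g (t p - \<tau>) + w N1 m0 t (2 * p) k * g' (t p - \<tau>))"

lemma reconstruct_shift:
  "reconstruct N1 m0 t (shift \<tau> f) (shift \<tau> f') x =
     (\<Sum>k=1..2 * m0. sample_coeff N1 m0 t f f' k \<tau> * cis (of_int (N1 + int k - 1) * x))"
proof -
  have "reconstruct N1 m0 t (shift \<tau> f) (shift \<tau> f') x =
     (\<Sum>p=1..m0. \<Sum>k=1..2 * m0. (w N1 m0 t (2 * p - 1) k * f (t p - \<tau>) + w N1 m0 t (2 * p) k * f' (t p - \<tau>)) *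
        cis (of_int (N1 + int k - 1) * x))"
    unfolding reconstruct_def shift_def \<phi>_def \<psi>_def
    unfolding sum_distrib_left sum.distrib[symmetric] by (intro sum.cong refl) (simp add: algebra_simps)
  then show ?thesis
    unfolding sample_coeff_def sum_distrib_right by (subst (asm) sum.swap)
qed

text \<open>For fixed \<open>\<tau>\<close> the samples are constants and remain those of
  \<open>f\<close>; only the function under the integral in \<open>x\<close> is replaced by
  \<open>F\<close>. Subtracting the reconstruction alters only the coefficients with index in
  \<open>I_set\<close>.\<close>

lemma norm2_error:
  assumes F: "continuous_on UNIV F" "periodic_2pi F" and eq: "AE x in lebesgue. f x = F x"
  shows "(norm2 (\<lambda>x. shift \<tau> f x - reconstruct N1 m0 t (shift \<tau> f) (shift \<tau> f') x))\<^sup>2 =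
    (\<Sum>\<^sub>\<infinity>n\<in>- I_set N1 m0. ennreal ((cmod (fc F n))\<^sup>2)) +
    (\<Sum>k=1..2 * m0. ennreal ((cmod (sample_coeff N1 m0 t f f' k \<tau> -
       fc F (N1 + int k - 1) * cis (- (of_int (N1 + int k - 1) * \<tau>))))\<^sup>2))"
proof -
  let ?I = "I_set N1 m0" and ?\<omega> = "\<lambda>k. N1 + int k - 1"
  have fin: "finite ?I" using bij_betw_finite[OF I_set_bij] by simp
  \<comment> \<open>\<open>nat (n - N1 + 1)\<close> is the index \<open>k\<close> whose frequency is
    \<open>n\<close>, so the reconstruction becomes a sum over \<open>I_set\<close> to which
    \<open>fc_trig_sum\<close> applies.\<close>
  define s where "s n = sample_coeff N1 m0 t f f' (nat (n - N1 + 1)) \<tau>" for n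
  have s: "s (?\<omega> k) = sample_coeff N1 m0 t f f' k \<tau>" for k by (simp add: s_def)
  define T where "T x = (\<Sum>n\<in>?I. s n * cis (of_int n * x))" for x
  have T: "reconstruct N1 m0 t (shift \<tau> f) (shift \<tau> f') x = T x" for x
    unfolding reconstruct_shift T_def
    by (subst sum.reindex_bij_betw[OF I_set_bij, symmetric]) (simp only: s)
  define g where "g x = F (x + (- \<tau>)) + (- 1) * T x" for x
  have cT: "continuous_on UNIV T" unfolding T_def by (intro continuous_intros)
  have cF: "continuous_on UNIV (\<lambda>x. F (x + (- \<tau>)))"
    by (intro continuous_on_compose2[OF F(1)] continuous_intros) auto
  have cg: "continuous_on UNIV g" unfolding g_def by (intro continuous_intros cF cT)
  have pg: "periodic_2pi g"
    unfolding periodic_2pi_def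
  proof
    fix x
    have "F (x + (- \<tau>) + 2 * pi) = F (x + (- \<tau>))" using F(2) unfolding periodic_2pi_def by blast
    moreover have "T (x + 2 * pi) = T x"
      using periodic_cis_int unfolding T_def periodic_2pi_def by simp
    ultimately show "g (x + 2 * pi) = g x" by (simp add: g_def algebra_simps)
  qed
  have fcg: "fc g n = cis (of_int n * (- \<tau>)) * fc F n + (- 1) * (if n \<in> ?I then s n else 0)" for n
  proof -
    have "fc g n = fc (\<lambda>x. F (x + (- \<tau>))) n + fc (\<lambda>x. (- 1) * T x) n"
      unfolding g_def by (intro fc_add continuous_UNIV_abs_integrable continuous_intros cF cT)
    then show ?thesis
      by (simp only: fc_cmult fc_shift[OF F(2,1)]) (simp only: T_def fc_trig_sum[OF fin])
  qed
  have "(norm2 (\<lambda>x. shift \<tau> f x - reconstruct N1 m0 t (shift \<tau> f) (shift \<tau> f') x))\<^sup>2 =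
      ennreal (1 / (2 * pi)) * (\<integral>\<^sup>+ x\<in>{0..2 * pi}. ennreal ((cmod (f (x - \<tau>) - T x))\<^sup>2) \<partial>lebesgue)"
    by (simp add: norm2_def ennreal_sqrt_power2 T shift_def)
  also have "(\<integral>\<^sup>+ x\<in>{0..2 * pi}. ennreal ((cmod (f (x - \<tau>) - T x))\<^sup>2) \<partial>lebesgue) =
      (\<integral>\<^sup>+ x\<in>{0..2 * pi}. ennreal ((cmod (g x))\<^sup>2) \<partial>lebesgue)"
    using AE_shift[OF eq, of "- \<tau>"] by (intro nn_integral_cong_AE) (auto simp: g_def elim!: eventually_mono)
  also have "ennreal (1 / (2 * pi)) * \<dots> = (\<Sum>\<^sub>\<infinity>n. ennreal ((cmod (fc g n))\<^sup>2))"
    by (intro weak_fourier_parseval weak_fourier_continuous pg cg)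
  also have "\<dots> = (\<Sum>\<^sub>\<infinity>n\<in>- ?I. ennreal ((cmod (fc g n))\<^sup>2)) + (\<Sum>n\<in>?I. ennreal ((cmod (fc g n))\<^sup>2))"
    by (rule ennreal_infsum_split[OF fin])
  also have "(\<Sum>\<^sub>\<infinity>n\<in>- ?I. ennreal ((cmod (fc g n))\<^sup>2)) = (\<Sum>\<^sub>\<infinity>n\<in>- ?I. ennreal ((cmod (fc F n))\<^sup>2))"
    by (intro infsum_cong) (simp add: fcg norm_mult)
  also have "(\<Sum>n\<in>?I. ennreal ((cmod (fc g n))\<^sup>2)) = (\<Sum>k=1..2 * m0. ennreal ((cmod (fc g (?\<omega> k)))\<^sup>2))"
    by (rule sum.reindex_bij_betw[OF I_set_bij, symmetric])
  also have "\<dots> = (\<Sum>k=1..2 * m0. ennreal ((cmod (sample_coeff N1 m0 t f f' k \<tau> -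
       fc F (?\<omega> k) * cis (- (of_int (?\<omega> k) * \<tau>))))\<^sup>2))"
  proof (rule sum.cong[OF refl])
    fix k assume "k \<in> {1..2 * m0}"
    then have "?\<omega> k \<in> ?I" by (auto simp: I_set_def)
    then have "fc g (?\<omega> k) = - (sample_coeff N1 m0 t f f' k \<tau> - fc F (?\<omega> k) * cis (- (of_int (?\<omega> k) * \<tau>)))"
      unfolding fcg by (simp only: s if_True) simp
    then show "ennreal ((cmod (fc g (?\<omega> k)))\<^sup>2) = ennreal ((cmod (sample_coeff N1 m0 t f f' k \<tau> -
       fc F (?\<omega> k) * cis (- (of_int (?\<omega> k) * \<tau>))))\<^sup>2)"
      by (simp only: norm_minus_cancel)
  qed
  finally show ?thesis .
qed

text \<open>The reflection in \<open>\<tau>\<close> places the response at \<open>n\<close> times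
  \<open>fc F n\<close> at frequency \<open>- n\<close>, where the subtracted exponential
  \<open>cis (- \<omega> * \<tau>)\<close> also has its only coefficient.\<close>

lemma weak_fourier_sample_error:
  assumes F: "continuous_on UNIV F" "periodic_2pi F"
    and F': "\<And>a b. a \<le> b \<Longrightarrow> (f' has_integral F b - F a) {a..b}"
  shows "weak_fourier (\<lambda>\<tau>. sample_coeff N1 m0 t F f' k \<tau> - fc F \<omega> * cis (- (of_int \<omega> * \<tau>)))
    (\<lambda>n. fc F (- n) * resp N1 m0 t k (- n) - (if - n = \<omega> then fc F \<omega> else 0))"
proof -
  have wF: "weak_fourier F (fc F)"
    by (rule weak_fourier_continuous[OF F(2,1)])
  \<comment> \<open>The primitive \<open>F\<close> is itself periodic, so \<open>f'\<close> has mean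
    0, as the formula gives at \<open>n = 0\<close>.\<close>
  have wf': "weak_fourier f' (\<lambda>n. \<i> * of_int n * fc F n)"
    by (rule weak_fourierI[of F]) (use F F' in auto)
  have we: "weak_fourier (\<lambda>\<tau>. cis (of_int (- \<omega>) * \<tau>)) (fc (\<lambda>\<tau>. cis (of_int (- \<omega>) * \<tau>)))"
    by (intro weak_fourier_continuous periodic_cis_int continuous_intros)
  define c where "c p n = w N1 m0 t (2 * p - 1) k * (cis (- (of_int n * t p)) * fc F (- n)) +
      w N1 m0 t (2 * p) k * (cis (- (of_int n * t p)) * (\<i> * of_int (- n) * fc F (- n)))" for p n
  have "weak_fourier (\<lambda>\<tau>. sample_coeff N1 m0 t F f' k \<tau> + (- fc F \<omega>) * cis (of_int (- \<omega>) * \<tau>))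
    (\<lambda>n. (\<Sum>p=1..m0. c p n) + (- fc F \<omega>) * fc (\<lambda>\<tau>. cis (of_int (- \<omega>) * \<tau>)) n)"
    unfolding sample_coeff_def c_def
    by (intro weak_fourier_add weak_fourier_sum weak_fourier_cmult we
        weak_fourier_reflect_shift[OF wF] weak_fourier_reflect_shift[OF wf']) simp
  moreover have "(\<Sum>p=1..m0. c p n) = fc F (- n) * resp N1 m0 t k (- n)" for n
    unfolding resp_def c_def sum_distrib_left by (intro sum.cong refl) (simp add: algebra_simps)
  moreover have "(- fc F \<omega>) * fc (\<lambda>\<tau>. cis (of_int (- \<omega>) * \<tau>)) n = - (if - n = \<omega> then fc F \<omega> else 0)" for n
    unfolding fc_cis by auto
  ultimately show ?thesis by simp
qed

theorem mainTheorem6: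
  fixes m0 :: nat and N1 :: int and t :: "nat \<Rightarrow> real" and f f' :: "real \<Rightarrow> complex"
  assumes "m0 \<ge> 1"
    and "\<forall>p\<in>{1..m0}. 0 \<le> t p \<and> t p < 2 * pi"
    and "strict_mono_on {1..m0} t"
    and "f \<in> L2_circle"
    and "circle_derivative f f'"
  shows "(averaged_error N1 m0 t f f')\<^sup>2 =
    (\<Sum>\<^sub>\<infinity>n\<in>- I_set N1 m0. ennreal ((cmod (fourier_coeff f n))\<^sup>2 * Er N1 m0 t n))"
proof -
  have f: "periodic_2pi f" "f \<in> borel_measurable lebesgue"
    using assms(4) by (auto simp: L2_circle_def)
  obtain F where F: "continuous_on UNIV F" "periodic_2pi F" and eq: "AE x in lebesgue. f x = F x"
    and F': "\<And>a b. a \<le> b \<Longrightarrow> (f' has_integral F b - F a) {a..b}"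
  proof (rule circle_derivativeE[OF assms(5) f(1)])
  qed (rule that, auto)
  let ?I = "I_set N1 m0" and ?S = "{0..2 * pi}" and ?K = "{1..2 * m0}"
  define c where "c k n = fc F (- n) * resp N1 m0 t k (- n) - (if - n = N1 + int k - 1 then fc F (N1 + int k - 1) else 0)" for k n
  define d where "d k \<tau> = sample_coeff N1 m0 t F f' k \<tau> - fc F (N1 + int k - 1) * cis (- (of_int (N1 + int k - 1) * \<tau>))" for k \<tau>
  have wf: "weak_fourier (d k) (c k)" for k
    unfolding c_def d_def by (rule weak_fourier_sample_error[OF F F'])
  define A where "A = (\<Sum>\<^sub>\<infinity>n\<in>- ?I. ennreal ((cmod (fc F n))\<^sup>2))"
  have meas: "(\<lambda>\<tau>. ennreal ((cmod (d k \<tau>))\<^sup>2) * indicator ?S \<tau>) \<in> borel_measurable lebesgue" for k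
    using weak_fourier_measurable_sq[OF wf] by simp
  have "(averaged_error N1 m0 t f f')\<^sup>2 = ennreal (1 / (2 * pi)) *
      (\<integral>\<^sup>+ \<tau>\<in>?S. (norm2 (\<lambda>x. shift \<tau> f x - reconstruct N1 m0 t (shift \<tau> f) (shift \<tau> f') x))\<^sup>2 \<partial>lebesgue)"
    by (simp add: averaged_error_def ennreal_sqrt_power2)
  also have "(\<integral>\<^sup>+ \<tau>\<in>?S. (norm2 (\<lambda>x. shift \<tau> f x - reconstruct N1 m0 t (shift \<tau> f) (shift \<tau> f') x))\<^sup>2 \<partial>lebesgue) =
      (\<integral>\<^sup>+ \<tau>. A * indicator ?S \<tau> + (\<Sum>k\<in>?K. ennreal ((cmod (d k \<tau>))\<^sup>2) * indicator ?S \<tau>) \<partial>lebesgue)"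
  proof (rule nn_integral_cong_AE)
    have "AE \<tau> in lebesgue. \<forall>p\<in>{1..m0}. f (t p - \<tau>) = F (t p - \<tau>)"
      using AE_reflect_shift[OF eq] by (intro AE_finite_allI) auto
    then show "AE \<tau> in lebesgue. (norm2 (\<lambda>x. shift \<tau> f x - reconstruct N1 m0 t (shift \<tau> f) (shift \<tau> f') x))\<^sup>2 * indicator ?S \<tau> =
        A * indicator ?S \<tau> + (\<Sum>k\<in>?K. ennreal ((cmod (d k \<tau>))\<^sup>2) * indicator ?S \<tau>)"
    proof eventually_elim
      case (elim \<tau>)
      then have "sample_coeff N1 m0 t f f' k \<tau> = sample_coeff N1 m0 t F f' k \<tau>" for k
        unfolding sample_coeff_def by (intro sum.cong) auto
      then show ?case
        unfolding norm2_error[OF F eq] A_def d_def by (simp only: distrib_right sum_distrib_right)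
    qed
  qed
  also have "\<dots> = A * ennreal (2 * pi) + (\<Sum>k\<in>?K. \<integral>\<^sup>+ \<tau>\<in>?S. ennreal ((cmod (d k \<tau>))\<^sup>2) \<partial>lebesgue)"
  proof -
    have "(\<lambda>\<tau>. A * indicator ?S \<tau>) \<in> borel_measurable lebesgue"
      by (intro borel_measurable_times_ennreal borel_measurable_const borel_measurable_indicator) simp
    moreover have "(\<lambda>\<tau>. \<Sum>k\<in>?K. ennreal ((cmod (d k \<tau>))\<^sup>2) * indicator ?S \<tau>) \<in> borel_measurable lebesgue"
      by (intro borel_measurable_sum meas)
    moreover have "(\<integral>\<^sup>+ \<tau>. A * indicator ?S \<tau> \<partial>lebesgue) = A * ennreal (2 * pi)"
      by (subst nn_integral_cmult_indicator) auto
    ultimately show ?thesis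
      by (simp only: nn_integral_add nn_integral_sum[OF meas])
  qed
  also have "ennreal (1 / (2 * pi)) * \<dots> = A + (\<Sum>k\<in>?K. \<Sum>\<^sub>\<infinity>n. ennreal ((cmod (c k n))\<^sup>2))"
  proof -
    have "ennreal (1 / (2 * pi)) * (A * ennreal (2 * pi)) = A * (ennreal (1 / (2 * pi)) * ennreal (2 * pi))"
      by (simp only: mult_ac)
    also have "\<dots> = A" by (simp add: ennreal_mult[symmetric])
    finally show ?thesis
      by (simp only: distrib_left sum_distrib_left weak_fourier_parseval[OF wf])
  qed
  also have "\<dots> = A + (\<Sum>k\<in>?K. \<Sum>\<^sub>\<infinity>n\<in>- ?I. ennreal ((cmod (fc F n))\<^sup>2 * (cmod (resp N1 m0 t k n))\<^sup>2))"
  proof (intro arg_cong2[where f = "(+)"] refl sum.cong)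
    \<comment> \<open>Reindexing by negation undoes the reflection of frequencies in
      \<open>c k\<close>.\<close>
    fix k assume k: "k \<in> ?K"
    have "(\<Sum>\<^sub>\<infinity>n. ennreal ((cmod (c k n))\<^sup>2)) = (\<Sum>\<^sub>\<infinity>n. ennreal ((cmod (c k (- n)))\<^sup>2))"
      by (rule infsum_reindex_bij_betw[symmetric, of uminus UNIV UNIV]) (simp add: bij_uminus)
    also have "\<dots> = (\<Sum>\<^sub>\<infinity>n\<in>- ?I. ennreal ((cmod (fc F n))\<^sup>2 * (cmod (resp N1 m0 t k n))\<^sup>2))"
    proof (rule infsum_cong_neutral)
      fix n assume "n \<in> UNIV - - ?I"
      then have "n \<in> (\<lambda>l. N1 + int l - 1) ` ?K"
        unfolding bij_betw_imp_surj_on[OF I_set_bij] by simp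
      then obtain l where l: "l \<in> ?K" "n = N1 + int l - 1"
        by blast
      \<comment> \<open>For \<open>l \<noteq> k\<close> the response is 0 and nothing is subtracted;
        for \<open>l = k\<close> the response is 1 and the subtracted coefficient cancels
        it.\<close>
      then have "c k (- n) = 0"
        using resp_eq_delta[OF assms(2,3) k l(1), of N1] by (auto simp: c_def)
      then show "ennreal ((cmod (c k (- n)))\<^sup>2) = 0" by simp
    next
      fix n assume "n \<in> UNIV \<inter> - ?I"
      then have "n \<noteq> N1 + int k - 1" using k by (auto simp: I_set_def)
      then show "ennreal ((cmod (c k (- n)))\<^sup>2) = ennreal ((cmod (fc F n))\<^sup>2 * (cmod (resp N1 m0 t k n))\<^sup>2)"
        by (simp add: c_def norm_mult power_mult_distrib)
    qed auto
    finally show "(\<Sum>\<^sub>\<infinity>n. ennreal ((cmod (c k n))\<^sup>2)) = \<dots>" .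
  qed
  also have "\<dots> = (\<Sum>\<^sub>\<infinity>n\<in>- ?I. ennreal ((cmod (fc F n))\<^sup>2) +
      (\<Sum>k\<in>?K. ennreal ((cmod (fc F n))\<^sup>2 * (cmod (resp N1 m0 t k n))\<^sup>2)))"
    unfolding A_def by (simp add: ennreal_infsum_sum infsum_add nonneg_summable_on_complete)
  also have "\<dots> = (\<Sum>\<^sub>\<infinity>n\<in>- ?I. ennreal ((cmod (fourier_coeff f n))\<^sup>2 * Er N1 m0 t n))"
  proof (rule infsum_cong)
    fix n
    \<comment> \<open>The summand 1 accounts for the lost component at frequency \<open>n\<close>,
      the sum for its aliases at the \<open>2 * m0\<close> reconstructed frequencies.\<close>
    have "Er N1 m0 t n = 1 + (\<Sum>k\<in>?K. (cmod (resp N1 m0 t k n))\<^sup>2)"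
      by (simp add: Er_def resp_def)
    then show "ennreal ((cmod (fc F n))\<^sup>2) + (\<Sum>k\<in>?K. ennreal ((cmod (fc F n))\<^sup>2 * (cmod (resp N1 m0 t k n))\<^sup>2)) =
        ennreal ((cmod (fourier_coeff f n))\<^sup>2 * Er N1 m0 t n)"
      unfolding fourier_coeff_eq_fc[OF f(2) F(1) eq]
      by (simp add: sum_ennreal ennreal_plus[symmetric] sum_nonneg distrib_left sum_distrib_left del: ennreal_plus)
  qed
  finally show ?thesis .
qed

end
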